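(* Let $\mathcal{M}=(K_{i(e)},w_e,p_e)_{e\in E}$ be a countable Markov system on a complete metric space $(K,d)$. (i) If $\mathcal{M}$ is uniformly continuous, then $\mathcal{M}$ is consistent if and only if $F(\Lambda)\in P(\mathcal{M})$ for all $\Lambda\in E_\perp(\mathcal{M})$. (ii) $\mathcal{M}$ is consistent if it is uniformly continuous and $$(Rf)\circ F(\sigma)\leq (Uf)\circ F(\sigma)\quad\text{for all }\sigma\in F^{-1}(\Omega)$$ and all bounded Borel measurable $f:K\to[0,\infty)$.
   Context: Setting. $(K,d)$ is a complete metric space; $P(X)$ denotes the Borel probability measures on $X$. A countable Markov system $\mathcal{M}=(K_{i(e)},w_e,p_e)_{e\in E}$ on $K$ consists of: a set $N\subset\mathbb{N}$ with $1\in N$; a partition $(K_j)_{j\in N}$ of $K$ into non-empty Borel sets; an at most countable set $E$; a surjective map $i:E\to N$ and a map $t:E\to N$; for each $e\in E$, Borel measurable $w_e:K_{i(e)}\to K_{t(e)}$ and $p_e:K_{i(e)}\to[0,1]$ with $p_e\not\equiv 0$, such that $\sum_{e\in E,\,i(e)=j}p_e(x)=1$ for all $x\in K_j$, $j\in N$. Each $p_e$ is extended to $K$ by zero and each $w_e$ is extended to a Borel map $K\to K$ arbitrarily. For Borel $f:K\to[0,\infty)$, $Uf:=\sum_{e\in E}p_e\,f\circ w_e$; $U^*\nu(f):=\int Uf\,d\nu$ for bounded such $f$, $\nu\in P(K)$. $P(\mathcal{M}):=\{\mu\in P(K): U^*\mu=\mu\}$. $\mathcal{M}$ is uniformly continuous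 iff $w_e|_{K_{i(e)}}$ and $p_e|_{K_{i(e)}}$ are uniformly continuous for each $e\in E$. In that case $\bar w_e$ is the continuous extension of $w_e|_{K_{i(e)}}$ to $\bar K_{i(e)}$ (extended arbitrarily to a Borel map on $K$), $\bar p_e$ is the continuous extension of $p_e|_{K_{i(e)}}$ to $\bar K_{i(e)}$, extended by zero to $K$, and $\partial p_e:=\bar p_e1_{\bar K_{i(e)}\setminus K_{i(e)}}$. $Rf:=\sum_{e\in E}\partial p_e\,f\circ\bar w_e$ for Borel $f:K\to[0,+\infty]$, and $\Omega:=\bigcap_{n\in\mathbb{N}}\{x\in K:(R^n1)(x)\ge1\}$. Code space. $\bar E:=E\cup\{\infty\}$ is the one-point compactification of discrete $E$; $w_\infty:=\mathrm{id}$, $p_\infty:=0$, $i(\infty)=t(\infty):=1$. $\bar\Sigma:=\bar E^{\mathbb{Z}}$ with the product topology; $(S\sigma)_{i-1}=\sigma_i$; $P_S(\bar\Sigma)$ is the set of $S$-invariant Borel probability measures. ${}_m[e_m,\dots,e_n]:=\{\sigma\in\bar\Sigma:\sigma_i=e_i,\ m\le i\le n\}$. $\mathcal{F}$ is the $\sigma$-algebra generated by all cylinders ${}_m[e_m,\dots,e_0]$, $m\le 0$. $\Sigma_G:=\{\sigma\in\bar\Sigma: \sigma_n\in E,\ i(\sigma_{n+1})=t(\sigma_n)\ \forall n\in\mathbb{Z}\}$. Fix $x_i\in K_i$ for each $i\in N$. $D:=\{\sigma\in\Sigma_G:\lim_{m\to-\infty}w_{\sigma_0}\circ\dots\circ w_{\sigma_m}(x_{i(\sigma_m)})\text{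 exists}\}$; $F:\bar\Sigma\to K$ is this limit on $D$, and $F(\sigma):=x_{t(\sigma_0)}$ for $\sigma\notin D$. $F(\Lambda):=\Lambda\circ F^{-1}$. $T_j:=\{\sigma\in\Sigma_G:t(\sigma_0)=j\}$. $\tilde E(\mathcal{M})$ (resp. $E_\perp(\mathcal{M})$) is the set of $\Lambda\in P_S(\bar\Sigma)$ with $\Lambda(D)=1$ and $E_\Lambda(1_{{}_1[e]}|\mathcal{F})=(\bar p_e\circ F)\,1_{T_{i(e)}}$ (resp. $=(\partial p_e\circ F)\,1_{T_{i(e)}}$) $\Lambda$-a.e. for all $e\in E$. A uniformly continuous $\mathcal{M}$ is consistent iff $F(M)\in P(\mathcal{M})$ for all $M\in\tilde E(\mathcal{M})$. *)

theory Defs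
  imports "HOL-Probability.Probability"
begin

(* The fields wmap and pmap hold the maps already extended to the whole space:
   wmap e is some Borel extension of w_e, and pmap e is the extension of p_e by zero. *)
record ('k, 'e) markov_system =
  vertices :: "nat set"
  atom :: "nat \<Rightarrow> 'k set"
  edges :: "'e set"
  src :: "'e \<Rightarrow> nat"
  tgt :: "'e \<Rightarrow> nat"
  wmap :: "'e \<Rightarrow> 'k \<Rightarrow> 'k"
  pmap :: "'e \<Rightarrow> 'k \<Rightarrow> real"

definition countable_markov_system :: "('k::complete_space, 'e) markov_system \<Rightarrow> bool" where
  "countable_markov_system M \<longleftrightarrow>
     1 \<in> vertices M \<and>
     (\<forall>j\<in>vertices M. atom M j \<noteq> {} \<and> atom M j \<in> sets borel) \<and>
     disjoint_family_on (atom M) (vertices M) \<and>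
     (\<Union>j\<in>vertices M. atom M j) = UNIV \<and>
     countable (edges M) \<and>
     src M ` edges M = vertices M \<and>
     tgt M ` edges M \<subseteq> vertices M \<and>
     (\<forall>e\<in>edges M.
        wmap M e \<in> borel_measurable borel \<and>
        wmap M e ` atom M (src M e) \<subseteq> atom M (tgt M e) \<and>
        pmap M e \<in> borel_measurable borel \<and>
        pmap M e ` atom M (src M e) \<subseteq> {0..1} \<and>
        (\<exists>y\<in>atom M (src M e). pmap M e y \<noteq> 0) \<and>
        (\<forall>y. y \<notin> atom M (src M e) \<longrightarrow> pmap M e y = 0)) \<and>
     (\<forall>j\<in>vertices M. \<forall>y\<in>atom M j.
        ((\<lambda>e. pmap M e y) has_sum 1) {e \<in> edges M. src M e = j})"

definition markov_op :: "('k, 'e) markov_system \<Rightarrow> ('k \<Rightarrow> ennreal) \<Rightarrow> 'k \<Rightarrow> ennreal" where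
  "markov_op M f y = (\<Sum>\<^sub>\<infinity>e\<in>edges M. ennreal (pmap M e y) * f (wmap M e y))"

definition markov_adj ::
    "('k, 'e) markov_system \<Rightarrow> 'k measure \<Rightarrow> ('k \<Rightarrow> ennreal) \<Rightarrow> ennreal" where
  "markov_adj M \<nu> f = (\<integral>\<^sup>+y. markov_op M f y \<partial>\<nu>)"

definition bounded_borel_nonneg :: "('k::topological_space \<Rightarrow> real) set" where
  "bounded_borel_nonneg =
     {f. f \<in> borel_measurable borel \<and> (\<forall>y. 0 \<le> f y) \<and> bounded (range f)}"

definition borel_prob :: "'k::topological_space measure set" where
  "borel_prob = {\<mu>. sets \<mu> = sets borel \<and> prob_space \<mu>}"

definition invariant_measures :: "('k::topological_space, 'e) markov_system \<Rightarrow> 'k measure set" where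
  "invariant_measures M =
     {\<mu> \<in> borel_prob. \<forall>f\<in>bounded_borel_nonneg.
        markov_adj M \<mu> (\<lambda>y. ennreal (f y)) = (\<integral>\<^sup>+y. ennreal (f y) \<partial>\<mu>)}"

definition unif_continuous :: "('k::metric_space, 'e) markov_system \<Rightarrow> bool" where
  "unif_continuous M \<longleftrightarrow>
     (\<forall>e\<in>edges M. uniformly_continuous_on (atom M (src M e)) (wmap M e) \<and>
                   uniformly_continuous_on (atom M (src M e)) (pmap M e))"

(* Only the values on the closure of S are meaningful; there the extension is unique. *)
definition cont_ext ::
    "'a::topological_space set \<Rightarrow> ('a \<Rightarrow> 'b::topological_space) \<Rightarrow> 'a \<Rightarrow> 'b" where
  "cont_ext S f = (SOME g. continuous_on (closure S) g \<and> (\<forall>y\<in>S. g y = f y))"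

definition pbar :: "('k::metric_space, 'e) markov_system \<Rightarrow> 'e \<Rightarrow> 'k \<Rightarrow> real" where
  "pbar M e y =
     (if y \<in> closure (atom M (src M e)) then cont_ext (atom M (src M e)) (pmap M e) y else 0)"

definition pbdry :: "('k::metric_space, 'e) markov_system \<Rightarrow> 'e \<Rightarrow> 'k \<Rightarrow> real" where
  "pbdry M e y =
     pbar M e y * indicator (closure (atom M (src M e)) - atom M (src M e)) y"

(* The extension beyond the closure is arbitrary, so it is a relation rather than a function. *)
definition is_wbar ::
    "('k::metric_space, 'e) markov_system \<Rightarrow> ('e \<Rightarrow> 'k \<Rightarrow> 'k) \<Rightarrow> bool" where
  "is_wbar M wb \<longleftrightarrow>
     (\<forall>e\<in>edges M. wb e \<in> borel_measurable borel \<and>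
        (\<forall>y\<in>closure (atom M (src M e)). wb e y = cont_ext (atom M (src M e)) (wmap M e) y))"

definition bdry_op ::
    "('k::metric_space, 'e) markov_system \<Rightarrow> ('e \<Rightarrow> 'k \<Rightarrow> 'k) \<Rightarrow> ('k \<Rightarrow> ennreal) \<Rightarrow> 'k \<Rightarrow> ennreal" where
  "bdry_op M wb f y = (\<Sum>\<^sub>\<infinity>e\<in>edges M. ennreal (pbdry M e y) * f (wb e y))"

definition Omega :: "('k::metric_space, 'e) markov_system \<Rightarrow> ('e \<Rightarrow> 'k \<Rightarrow> 'k) \<Rightarrow> 'k set" where
  "Omega M wb = (\<Inter>n. {y. (bdry_op M wb ^^ n) (\<lambda>_. 1) y \<ge> 1})"

(* An edge e is the letter Some e; the point at infinity is None. *)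
definition code_top :: "('k, 'e) markov_system \<Rightarrow> (int \<Rightarrow> 'e option) topology" where
  "code_top M =
     product_topology (\<lambda>_. Alexandroff_compactification (discrete_topology (edges M))) UNIV"

abbreviation code_space :: "('k, 'e) markov_system \<Rightarrow> (int \<Rightarrow> 'e option) set" where
  "code_space M \<equiv> topspace (code_top M)"

definition code_borel :: "('k, 'e) markov_system \<Rightarrow> (int \<Rightarrow> 'e option) measure" where
  "code_borel M = sigma (code_space M) {V. openin (code_top M) V}"

definition src_ext :: "('k, 'e) markov_system \<Rightarrow> 'e option \<Rightarrow> nat" where
  "src_ext M a = (case a of None \<Rightarrow> 1 | Some e \<Rightarrow> src M e)"

definition tgt_ext :: "('k, 'e) markov_system \<Rightarrow> 'e option \<Rightarrow> nat" where
  "tgt_ext M a = (case a of None \<Rightarrow> 1 | Some e \<Rightarrow> tgt M e)"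

definition wmap_ext :: "('k, 'e) markov_system \<Rightarrow> 'e option \<Rightarrow> 'k \<Rightarrow> 'k" where
  "wmap_ext M a = (case a of None \<Rightarrow> id | Some e \<Rightarrow> wmap M e)"

definition code_shift :: "(int \<Rightarrow> 'a) \<Rightarrow> int \<Rightarrow> 'a" where
  "code_shift \<sigma> = (\<lambda>k. \<sigma> (k + 1))"

definition shift_invariant_measures ::
    "('k, 'e) markov_system \<Rightarrow> (int \<Rightarrow> 'e option) measure set" where
  "shift_invariant_measures M =
     {\<Lambda>. sets \<Lambda> = sets (code_borel M) \<and> prob_space \<Lambda> \<and>
          distr \<Lambda> (code_borel M) code_shift = \<Lambda>}"

(* Only the letters c m, ..., c n matter. *)
definition cylinder ::
    "('k, 'e) markov_system \<Rightarrow> int \<Rightarrow> int \<Rightarrow> (int \<Rightarrow> 'e option) \<Rightarrow> (int \<Rightarrow> 'e option) set" where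
  "cylinder M m n c = {\<sigma> \<in> code_space M. \<forall>k\<in>{m..n}. \<sigma> k = c k}"

definition past_algebra :: "('k, 'e) markov_system \<Rightarrow> (int \<Rightarrow> 'e option) measure" where
  "past_algebra M =
     sigma (code_space M) {cylinder M m 0 c | m c. m \<le> 0 \<and> c \<in> code_space M}"

definition path_space :: "('k, 'e) markov_system \<Rightarrow> (int \<Rightarrow> 'e option) set" where
  "path_space M =
     {\<sigma> \<in> code_space M. \<forall>n. \<sigma> n \<in> Some ` edges M \<and> src_ext M (\<sigma> (n + 1)) = tgt_ext M (\<sigma> n)}"

definition paths_ending_at :: "('k, 'e) markov_system \<Rightarrow> nat \<Rightarrow> (int \<Rightarrow> 'e option) set" where
  "paths_ending_at M j = {\<sigma> \<in> path_space M. tgt_ext M (\<sigma> 0) = j}"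

(* w_comp M \<sigma> n = w_{\<sigma>(0)} o w_{\<sigma>(-1)} o ... o w_{\<sigma>(-n)} *)
primrec w_comp :: "('k, 'e) markov_system \<Rightarrow> (int \<Rightarrow> 'e option) \<Rightarrow> nat \<Rightarrow> 'k \<Rightarrow> 'k" where
  "w_comp M \<sigma> 0 = wmap_ext M (\<sigma> 0)"
| "w_comp M \<sigma> (Suc n) = w_comp M \<sigma> n \<circ> wmap_ext M (\<sigma> (- int (Suc n)))"

definition coding_seq ::
    "('k, 'e) markov_system \<Rightarrow> (nat \<Rightarrow> 'k) \<Rightarrow> (int \<Rightarrow> 'e option) \<Rightarrow> nat \<Rightarrow> 'k" where
  "coding_seq M x \<sigma> n = w_comp M \<sigma> n (x (src_ext M (\<sigma> (- int n))))"

definition coding_dom ::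
    "('k::metric_space, 'e) markov_system \<Rightarrow> (nat \<Rightarrow> 'k) \<Rightarrow> (int \<Rightarrow> 'e option) set" where
  "coding_dom M x = {\<sigma> \<in> path_space M. convergent (coding_seq M x \<sigma>)}"

definition coding_map ::
    "('k::metric_space, 'e) markov_system \<Rightarrow> (nat \<Rightarrow> 'k) \<Rightarrow> (int \<Rightarrow> 'e option) \<Rightarrow> 'k" where
  "coding_map M x \<sigma> =
     (if \<sigma> \<in> coding_dom M x then lim (coding_seq M x \<sigma>) else x (tgt_ext M (\<sigma> 0)))"

definition coding_image ::
    "('k::metric_space, 'e) markov_system \<Rightarrow> (nat \<Rightarrow> 'k) \<Rightarrow> (int \<Rightarrow> 'e option) measure \<Rightarrow> 'k measure" where
  "coding_image M x \<Lambda> = distr \<Lambda> borel (coding_map M x)"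

definition states_with_weight ::
    "('k::metric_space, 'e) markov_system \<Rightarrow> (nat \<Rightarrow> 'k) \<Rightarrow> ('e \<Rightarrow> 'k \<Rightarrow> real) \<Rightarrow>
     (int \<Rightarrow> 'e option) measure set" where
  "states_with_weight M x q =
     {\<Lambda> \<in> shift_invariant_measures M.
        emeasure \<Lambda> (coding_dom M x) = 1 \<and>
        (\<forall>e\<in>edges M. AE \<sigma> in \<Lambda>.
           real_cond_exp \<Lambda> (past_algebra M) (indicator (cylinder M 1 1 (\<lambda>_. Some e))) \<sigma> =
           q e (coding_map M x \<sigma>) * indicator (paths_ending_at M (src M e)) \<sigma>)}"

definition E_tilde ::
    "('k::metric_space, 'e) markov_system \<Rightarrow> (nat \<Rightarrow> 'k) \<Rightarrow> (int \<Rightarrow> 'e option) measure set" where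
  "E_tilde M x = states_with_weight M x (pbar M)"

definition E_perp ::
    "('k::metric_space, 'e) markov_system \<Rightarrow> (nat \<Rightarrow> 'k) \<Rightarrow> (int \<Rightarrow> 'e option) measure set" where
  "E_perp M x = states_with_weight M x (pbdry M)"

definition consistent :: "('k::metric_space, 'e) markov_system \<Rightarrow> (nat \<Rightarrow> 'k) \<Rightarrow> bool" where
  "consistent M x \<longleftrightarrow> (\<forall>\<Lambda>\<in>E_tilde M x. coding_image M x \<Lambda> \<in> invariant_measures M)"

end

theory Submission
  imports Defs
begin

text \<open>
  Let \<open>F\<close> be the coding map, \<open>S\<close> the shift and \<open>\<Lambda>\<close> a state, that is, a shift-invariant measure for which the
  conditional probability of the next letter \<open>e\<close> given the past is \<open>q\<^sub>e \<circ> F\<close> on the paths that end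
  where \<open>e\<close> starts. Along a path with next letter \<open>e\<close> the point \<open>F \<circ> S\<close> is the image of \<open>F\<close> under the
  extended map of \<open>e\<close>. Summing over \<open>e\<close> yields the one-step identity
  (\<open>one_step_identity\<close>): the integral of \<open>f \<circ> F \<circ> S\<close> against any nonnegative function of the past is that of the
  sum of \<open>q\<^sub>e \<circ> F\<close> times \<open>f\<close> at the image points.

  For the equivalence, note that \<open>F\<close> almost surely lies in the closure of the atom at which the path ends. The paths for
  which it lies in that atom itself form the inner part. Since edges map atoms into atoms, the inner
  part is forward invariant under the shift, hence invariant up to a null set. On the inner part
  the extended weights and maps are the original ones, and the one-step identity, whose left-hand side
  is the integral of \<open>f \<circ> F\<close> by shift invariance, says that the image
  is invariant under the Markov operator (\<open>inner_part_balance\<close>). On the complement the extended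
  weights are the boundary weights, so, unless the complement is null, the state conditioned on it is a
  boundary state, that is, a state for the boundary weights
  (\<open>conditioned_outer_part_in_E_perp\<close>). Thus every state is a mixture of a part with invariant image and of a boundary state, and
  invariance for all boundary states gives consistency. Conversely, boundary weights can have total mass 1 only off
  the atom, where they equal the extended weights, so boundary states
  are among the states that define consistency (\<open>E_perp_subset_E_tilde\<close>).

  For the sufficient condition, iterating the one-step identity shows that a boundary state is carried by
  the paths coded into \<^const>\<open>Omega\<close> (\<open>E_perp_AE_Omega\<close>). There the hypothesis bounds the boundary operator by the
  Markov operator, so the image measure \<open>\<nu>\<close> satisfies \<open>\<nu>(f) \<le> \<nu>(Uf)\<close>; replacing \<open>f\<close> by \<open>c - f\<close> turns this into
  an equality (\<open>consistent_if_dominated\<close>).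
\<close>

section \<open>Sums of nonnegative extended reals as integrals\<close>

lemma infsum_ennreal_eq_nn_integral:
  fixes f :: "'i \<Rightarrow> ennreal"
  assumes "countable I"
  shows "(\<Sum>\<^sub>\<infinity>i\<in>I. f i) = (\<integral>\<^sup>+i. f i \<partial>count_space I)"
proof (cases "finite I")
  case True
  then show ?thesis by (simp add: nn_integral_count_space_finite)
next
  case False
  obtain g where g: "bij_betw g (UNIV :: nat set) I"
    using assms False bij_betw_from_nat_into by blast
  have inj: "inj_on g A" for A
    using g by (meson bij_betw_imp_inj_on inj_on_subset subset_UNIV)
  have partial: "(\<Sum>i<n. f (g i)) = sum f (g ` {..<n})" for n
    using inj by (simp add: sum.reindex)
  have "(\<integral>\<^sup>+i. f i \<partial>count_space I) = (\<Sum>n. f (g n))"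
    using nn_integral_bij_count_space[OF g, of f] by (simp add: nn_integral_count_space_nat)
  also have "\<dots> = (SUP n. sum f (g ` {..<n}))"
    by (simp add: suminf_eq_SUP partial)
  also have "\<dots> = (SUP A\<in>{A. finite A \<and> A \<subseteq> I}. sum f A)"
  proof (rule antisym)
    show "(SUP n. sum f (g ` {..<n})) \<le> (SUP A\<in>{A. finite A \<and> A \<subseteq> I}. sum f A)"
      using g by (intro SUP_least SUP_upper) (auto simp: bij_betw_def)
    show "(SUP A\<in>{A. finite A \<and> A \<subseteq> I}. sum f A) \<le> (SUP n. sum f (g ` {..<n}))"
    proof (intro SUP_least, clarify)
      fix A assume A: "finite A" "A \<subseteq> I"
      obtain B where B: "finite B" "A = g ` B"
        using A g by (metis bij_betw_def finite_subset_image)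
      obtain n where "B \<subseteq> {..<n}"
        using B(1) finite_nat_iff_bounded by blast
      then have "sum f A \<le> sum f (g ` {..<n})"
        using B by (intro sum_mono2) auto
      also have "\<dots> \<le> (SUP n. sum f (g ` {..<n}))"
        by (intro SUP_upper) auto
      finally show "sum f A \<le> (SUP n. sum f (g ` {..<n}))" .
    qed
  qed
  also have "\<dots> = (\<Sum>\<^sub>\<infinity>i\<in>I. f i)"
    by (subst nonneg_infsum_complete) auto
  finally show ?thesis ..
qed

lemma has_sum_nn_integral_count_space:
  fixes f :: "'i \<Rightarrow> real"
  assumes "(f has_sum s) I" "countable I" "\<And>i. i \<in> I \<Longrightarrow> f i \<ge> 0"
  shows "(\<integral>\<^sup>+i. ennreal (f i) \<partial>count_space I) = ennreal s"
proof -
  have "ennreal s = (SUP A\<in>{A. finite A \<and> A \<subseteq> I}. ennreal (sum f A))"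
    using infsum_nonneg_is_SUPREMUM_ennreal[of f I] assms
    by (metis has_sum_imp_summable infsumI)
  also have "\<dots> = (SUP A\<in>{A. finite A \<and> A \<subseteq> I}. \<Sum>i\<in>A. ennreal (f i))"
    using assms(3) by (intro SUP_cong) (auto intro!: sum_ennreal[symmetric])
  also have "\<dots> = (\<Sum>\<^sub>\<infinity>i\<in>I. ennreal (f i))"
    by (subst nonneg_infsum_complete) auto
  finally show ?thesis
    using assms(2) by (simp add: infsum_ennreal_eq_nn_integral)
qed

lemma borel_measurable_count_space_integral:
  fixes f :: "'i \<Rightarrow> 'a \<Rightarrow> ennreal"
  assumes "countable I" and [measurable]: "\<And>i. i \<in> I \<Longrightarrow> f i \<in> borel_measurable N"
  shows "(\<lambda>y. \<integral>\<^sup>+i. f i y \<partial>count_space I) \<in> borel_measurable N"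
proof -
  have "(\<lambda>y. SUP A\<in>{A. finite A \<and> A \<subseteq> I}. \<Sum>i\<in>A. f i y) \<in> borel_measurable N"
    using countable_Collect_finite_subset[OF assms(1)]
    by (intro borel_measurable_SUP borel_measurable_sum) auto
  then show ?thesis
    by (simp add: infsum_ennreal_eq_nn_integral[OF assms(1), symmetric] nonneg_infsum_complete)
qed

section \<open>Conditional probabilities tested against nonnegative functions\<close>

text \<open>The integrals on the right-hand side can be interchanged with countable sums over the edges
  without any integrability condition, and a factor measurable in the past can be absorbed into
  \<^term>\<open>g\<close>. The two sides are the integrals of \<^term>\<open>g\<close> over two measures on \<^term>\<open>F\<close>, with densities
  \<^term>\<open>indicator C\<close> and \<^term>\<open>q\<close>; the defining property of conditional expectation says that these measures
  agree on every set of \<^term>\<open>F\<close>.\<close>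
lemma cond_exp_indicator_iff_nn_integral:
  assumes "prob_space \<Lambda>" and sub: "subalgebra \<Lambda> F" and C[measurable]: "C \<in> sets \<Lambda>"
    and q[measurable]: "q \<in> borel_measurable F" and q0: "\<And>\<sigma>. q \<sigma> \<ge> (0::real)"
  shows "(AE \<sigma> in \<Lambda>. real_cond_exp \<Lambda> F (indicator C) \<sigma> = q \<sigma>) \<longleftrightarrow>
     (\<forall>g\<in>borel_measurable F. (\<integral>\<^sup>+\<sigma>. g \<sigma> * indicator C \<sigma> \<partial>\<Lambda>) = (\<integral>\<^sup>+\<sigma>. g \<sigma> * ennreal (q \<sigma>) \<partial>\<Lambda>))"
proof -
  interpret prob_space \<Lambda> by fact
  interpret finite_measure_subalgebra \<Lambda> F by unfold_locales fact
  have q'[measurable]: "q \<in> borel_measurable \<Lambda>" using measurable_from_subalg[OF sub q] .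
  have intC: "integrable \<Lambda> (\<lambda>\<sigma>. indicator A \<sigma> * indicator C \<sigma> :: real)" if "A \<in> sets \<Lambda>" for A
    using that C by (intro integrable_const_bound[of _ 1]) (auto simp: indicator_def)
  show ?thesis
  proof
    assume ae: "AE \<sigma> in \<Lambda>. real_cond_exp \<Lambda> F (indicator C) \<sigma> = q \<sigma>"
    have int1: "integrable \<Lambda> (indicator C :: _ \<Rightarrow> real)"
      using C by (intro integrable_const_bound[of _ 1]) (auto simp: indicator_def)
    have "integrable \<Lambda> (real_cond_exp \<Lambda> F (indicator C))"
      using int1 by (rule real_cond_exp_int)
    then have intq: "integrable \<Lambda> q"
      by (rule integrable_cong_AE_imp) (use ae in \<open>simp_all add: eq_commute\<close>)
    have sets_eq: "(\<integral>\<^sup>+\<sigma>. indicator C \<sigma> * indicator A \<sigma> \<partial>\<Lambda>) = (\<integral>\<^sup>+\<sigma>. ennreal (q \<sigma>) * indicator A \<sigma> \<partial>\<Lambda>)"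
      if A: "A \<in> sets F" for A
    proof -
      have [measurable]: "A \<in> sets \<Lambda>" using A sub by (auto simp: subalgebra_def)
      have intqA: "integrable \<Lambda> (\<lambda>\<sigma>. indicator A \<sigma> * q \<sigma>)"
        using integrable_mult_indicator[OF _ intq, of A] by simp
      have "(\<integral>\<^sup>+\<sigma>. indicator C \<sigma> * indicator A \<sigma> \<partial>\<Lambda>) = (\<integral>\<^sup>+\<sigma>. ennreal (indicator A \<sigma> * indicator C \<sigma>) \<partial>\<Lambda>)"
        by (intro nn_integral_cong) (auto simp: indicator_def)
      also have "\<dots> = ennreal (\<integral>\<sigma>. indicator A \<sigma> * indicator C \<sigma> \<partial>\<Lambda>)"
        by (intro nn_integral_eq_integral intC) auto
      also have "(\<integral>\<sigma>. indicator A \<sigma> * indicator C \<sigma> \<partial>\<Lambda>) = (\<integral>\<sigma>. indicator A \<sigma> * real_cond_exp \<Lambda> F (indicator C) \<sigma> \<partial>\<Lambda>)"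
        using A by (intro real_cond_exp_intg(2)[symmetric] intC) auto
      also have "\<dots> = (\<integral>\<sigma>. indicator A \<sigma> * q \<sigma> \<partial>\<Lambda>)"
      proof (rule integral_cong_AE)
        show "AE \<sigma> in \<Lambda>. indicator A \<sigma> * real_cond_exp \<Lambda> F (indicator C) \<sigma> = indicator A \<sigma> * q \<sigma>"
          using ae by eventually_elim simp
      qed measurable
      also have "ennreal \<dots> = (\<integral>\<^sup>+\<sigma>. ennreal (indicator A \<sigma> * q \<sigma>) \<partial>\<Lambda>)"
        using q0 by (intro nn_integral_eq_integral[symmetric] intqA) (auto simp: indicator_def)
      also have "\<dots> = (\<integral>\<^sup>+\<sigma>. ennreal (q \<sigma>) * indicator A \<sigma> \<partial>\<Lambda>)"
        by (intro nn_integral_cong) (auto simp: indicator_def)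
      finally show ?thesis .
    qed
    show "\<forall>g\<in>borel_measurable F. (\<integral>\<^sup>+\<sigma>. g \<sigma> * indicator C \<sigma> \<partial>\<Lambda>) = (\<integral>\<^sup>+\<sigma>. g \<sigma> * ennreal (q \<sigma>) \<partial>\<Lambda>)"
    proof
      fix g :: "_ \<Rightarrow> ennreal" assume g: "g \<in> borel_measurable F"
      let ?N1 = "density \<Lambda> (indicator C)" and ?N2 = "density \<Lambda> (\<lambda>\<sigma>. ennreal (q \<sigma>))"
      have s: "subalgebra ?N1 F" "subalgebra ?N2 F" using sub by (auto simp: subalgebra_def)
      have eq: "restr_to_subalg ?N1 F = restr_to_subalg ?N2 F"
      proof (rule measure_eqI)
        show "sets (restr_to_subalg ?N1 F) = sets (restr_to_subalg ?N2 F)"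
          using s by (simp add: sets_restr_to_subalg)
        fix A assume "A \<in> sets (restr_to_subalg ?N1 F)"
        then have A: "A \<in> sets F" using s by (simp add: sets_restr_to_subalg)
        then have "A \<in> sets \<Lambda>" using sub by (auto simp: subalgebra_def)
        then show "emeasure (restr_to_subalg ?N1 F) A = emeasure (restr_to_subalg ?N2 F) A"
          using s A sets_eq[OF A] by (simp add: emeasure_restr_to_subalg emeasure_density)
      qed
      have g': "g \<in> borel_measurable \<Lambda>" using measurable_from_subalg[OF sub g] .
      have "(\<integral>\<^sup>+\<sigma>. g \<sigma> * indicator C \<sigma> \<partial>\<Lambda>) = (\<integral>\<^sup>+\<sigma>. g \<sigma> \<partial>?N1)"
        using g' by (subst nn_integral_density) (auto simp: mult.commute)
      also have "\<dots> = (\<integral>\<^sup>+\<sigma>. g \<sigma> \<partial>restr_to_subalg ?N1 F)"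
        by (rule nn_integral_subalgebra2[symmetric, OF s(1) g])
      also have "\<dots> = (\<integral>\<^sup>+\<sigma>. g \<sigma> \<partial>?N2)"
        unfolding eq by (rule nn_integral_subalgebra2[OF s(2) g])
      also have "\<dots> = (\<integral>\<^sup>+\<sigma>. g \<sigma> * ennreal (q \<sigma>) \<partial>\<Lambda>)"
        using g' by (subst nn_integral_density) (auto simp: mult.commute)
      finally show "(\<integral>\<^sup>+\<sigma>. g \<sigma> * indicator C \<sigma> \<partial>\<Lambda>) = (\<integral>\<^sup>+\<sigma>. g \<sigma> * ennreal (q \<sigma>) \<partial>\<Lambda>)" .
    qed
  next
    assume *: "\<forall>g\<in>borel_measurable F. (\<integral>\<^sup>+\<sigma>. g \<sigma> * indicator C \<sigma> \<partial>\<Lambda>) = (\<integral>\<^sup>+\<sigma>. g \<sigma> * ennreal (q \<sigma>) \<partial>\<Lambda>)"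
    have setI: "(\<integral>\<sigma>. indicator A \<sigma> * indicator C \<sigma> \<partial>\<Lambda>) = (\<integral>\<sigma>. indicator A \<sigma> * q \<sigma> \<partial>\<Lambda>)"
      if A: "A \<in> sets F" for A
    proof -
      have [measurable]: "A \<in> sets \<Lambda>" using A sub by (auto simp: subalgebra_def)
      have "(\<integral>\<sigma>. indicator A \<sigma> * indicator C \<sigma> \<partial>\<Lambda>) = enn2real (\<integral>\<^sup>+\<sigma>. indicator A \<sigma> * indicator C \<sigma> \<partial>\<Lambda>)"
        by (subst integral_eq_nn_integral)
          (auto intro!: arg_cong[of _ _ enn2real] nn_integral_cong simp: indicator_def)
      also have "\<dots> = enn2real (\<integral>\<^sup>+\<sigma>. indicator A \<sigma> * ennreal (q \<sigma>) \<partial>\<Lambda>)"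
        using * A by simp
      also have "\<dots> = (\<integral>\<sigma>. indicator A \<sigma> * q \<sigma> \<partial>\<Lambda>)"
        using q0 by (subst integral_eq_nn_integral)
          (auto intro!: arg_cong[of _ _ enn2real] nn_integral_cong simp: indicator_def)
      finally show ?thesis .
    qed
    show "AE \<sigma> in \<Lambda>. real_cond_exp \<Lambda> F (indicator C) \<sigma> = q \<sigma>"
    proof (rule real_cond_exp_charact)
      show "integrable \<Lambda> (indicator C :: _ \<Rightarrow> real)"
        using C by (intro integrable_const_bound[of _ 1]) (auto simp: indicator_def)
      have "(\<integral>\<^sup>+\<sigma>. ennreal (q \<sigma>) \<partial>\<Lambda>) = (\<integral>\<^sup>+\<sigma>. 1 * indicator C \<sigma> \<partial>\<Lambda>)"
        using bspec[OF *, of "\<lambda>_. 1"] by simp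
      also have "\<dots> = emeasure \<Lambda> C" by simp
      also have "\<dots> < \<infinity>" by (simp add: less_top[symmetric])
      finally show "integrable \<Lambda> q" using q0 by (intro integrableI_nonneg) auto
    qed (use setI q in \<open>auto simp: set_lebesgue_integral_def\<close>)
  qed
qed

section \<open>The code space and its past algebra\<close>

lemma code_space_iff:
  "\<sigma> \<in> code_space M \<longleftrightarrow> (\<forall>k. \<sigma> k \<in> insert None (Some ` edges M))"
  by (auto simp: code_top_def PiE_iff)

lemma space_code_borel [simp]: "space (code_borel M) = code_space M"
  by (simp add: code_borel_def space_measure_of_conv)

lemma space_past_algebra [simp]: "space (past_algebra M) = code_space M"
  by (simp add: past_algebra_def space_measure_of_conv)

lemma open_in_code_borel: "openin (code_top M) V \<Longrightarrow> V \<in> sets (code_borel M)"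
  unfolding code_borel_def by (subst sets_measure_of) (auto dest: openin_subset)

lemma coordinate_in_code_borel: "{\<sigma> \<in> code_space M. \<sigma> k = a} \<in> sets (code_borel M)"
proof -
  have opn: "{\<sigma> \<in> code_space M. \<sigma> k \<in> Some ` U} \<in> sets (code_borel M)" if "U \<subseteq> edges M" for U
  proof (rule open_in_code_borel)
    have "continuous_map (code_top M) (Alexandroff_compactification (discrete_topology (edges M))) (\<lambda>\<sigma>. \<sigma> k)"
      unfolding code_top_def by (rule continuous_map_product_projection) simp
    then show "openin (code_top M) {\<sigma> \<in> code_space M. \<sigma> k \<in> Some ` U}"
      by (rule openin_continuous_map_preimage) (use that in simp)
  qed
  consider e where "a = Some e" "e \<in> edges M" | e where "a = Some e" "e \<notin> edges M" | "a = None"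
    by (cases a) auto
  then show ?thesis
  proof cases
    case (1 e)
    then show ?thesis using opn[of "{e}"] by simp
  next
    case (2 e)
    then have "{\<sigma> \<in> code_space M. \<sigma> k = a} = {}" by (auto simp: code_space_iff)
    then show ?thesis by (metis sets.empty_sets)
  next
    case 3
    have letter: "\<sigma> k \<in> insert None (Some ` edges M)" if "\<sigma> \<in> code_space M" for \<sigma>
      using that unfolding code_space_iff by (rule spec)
    have "\<sigma> k = a \<longleftrightarrow> \<sigma> k \<notin> Some ` edges M" if "\<sigma> \<in> code_space M" for \<sigma>
      using letter[OF that] 3 by auto
    then have "{\<sigma> \<in> code_space M. \<sigma> k = a}
        = {\<sigma> \<in> space (code_borel M). \<not> \<sigma> k \<in> Some ` edges M}"
      unfolding space_code_borel by (intro Collect_cong conj_cong) (rule refl)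
    then show ?thesis using opn[of "edges M"] sets.sets_Collect_neg[of "code_borel M" "\<lambda>\<sigma>. \<sigma> k \<in> Some ` edges M"] by simp
  qed
qed

lemma cylinder_in_code_borel: "cylinder M m n c \<in> sets (code_borel M)"
proof -
  have "{\<sigma> \<in> space (code_borel M). \<forall>k\<in>{m..n}. \<sigma> k = c k} \<in> sets (code_borel M)"
    using coordinate_in_code_borel[of M]
    by (intro sets.sets_Collect_finite_All) auto
  then show ?thesis by (simp add: cylinder_def)
qed

lemma cylinder_in_past_algebra:
  "m \<le> 0 \<Longrightarrow> c \<in> code_space M \<Longrightarrow> cylinder M m 0 c \<in> sets (past_algebra M)"
  unfolding past_algebra_def by (subst sets_measure_of) (auto simp: cylinder_def)

lemma subalgebra_past_algebra:
  assumes "sets \<Lambda> = sets (code_borel M)"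
  shows "subalgebra \<Lambda> (past_algebra M)"
proof -
  have "sets (past_algebra M) \<subseteq> sets (code_borel M)"
    unfolding past_algebra_def using cylinder_in_code_borel[of M]
    by (subst sets_measure_of)
      (auto simp: cylinder_def intro!: sets.sigma_sets_subset[of _ "code_borel M", simplified])
  then show ?thesis
    using assms sets_eq_imp_space_eq[OF assms] by (simp add: subalgebra_def)
qed

lemma shift_in_code_space [simp]: "code_shift \<sigma> \<in> code_space M \<longleftrightarrow> \<sigma> \<in> code_space M"
  unfolding code_space_iff code_shift_def by (metis diff_add_cancel)

lemma measurable_code_shift: "code_shift \<in> measurable (code_borel M) (code_borel M)"
proof -
  have "continuous_map (code_top M) (code_top M) code_shift"
    unfolding code_top_def continuous_map_componentwise_UNIV code_shift_def
    by (auto intro: continuous_map_product_projection)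
  then have pre: "openin (code_top M) {\<sigma> \<in> code_space M. code_shift \<sigma> \<in> V}" if "openin (code_top M) V" for V
    using that by (rule openin_continuous_map_preimage)
  show ?thesis
  proof (rule measurable_sigma_sets)
    show "sets (code_borel M) = sigma_sets (code_space M) {V. openin (code_top M) V}"
      unfolding code_borel_def by (subst sets_measure_of) (auto dest: openin_subset)
    show "{V. openin (code_top M) V} \<subseteq> Pow (code_space M)"
      by (auto dest: openin_subset)
    show "code_shift \<in> space (code_borel M) \<rightarrow> code_space M"
      by simp
    fix V assume "V \<in> {V. openin (code_top M) V}"
    then have "{\<sigma> \<in> code_space M. code_shift \<sigma> \<in> V} \<in> sets (code_borel M)"
      using pre by (blast intro: open_in_code_borel)
    also have "{\<sigma> \<in> code_space M. code_shift \<sigma> \<in> V} = code_shift -` V \<inter> space (code_borel M)"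
      by auto
    finally show "code_shift -` V \<inter> space (code_borel M) \<in> sets (code_borel M)" .
  qed
qed

text \<open>The alphabet is countable, so a condition on finitely many letters is a countable union of cylinders.\<close>
lemma finite_window_in_sets:
  fixes N :: "(int \<Rightarrow> 'e option) measure"
  assumes E: "countable (edges M)"
    and cyl: "\<And>c. c \<in> code_space M \<Longrightarrow> cylinder M m n c \<in> sets N"
    and P: "\<And>\<sigma> \<tau>. \<sigma> \<in> code_space M \<Longrightarrow> \<tau> \<in> code_space M \<Longrightarrow>
              (\<And>k. m \<le> k \<Longrightarrow> k \<le> n \<Longrightarrow> \<sigma> k = \<tau> k) \<Longrightarrow> P \<sigma> \<Longrightarrow> P \<tau>"
  shows "{\<sigma> \<in> code_space M. P \<sigma>} \<in> sets N"
proof -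
  \<comment> \<open>A cylinder depends only on the restriction of its word to the window, and there are countably many such restrictions.\<close>
  define G where "G = (\<lambda>d. {\<sigma> \<in> code_space M. \<forall>k\<in>{m..n}. \<sigma> k = d k})"
  have "cylinder M m n c \<in> G ` (PiE {m..n} (\<lambda>_. insert None (Some ` edges M)))"
    if "c \<in> code_space M" for c
  proof (rule image_eqI)
    show "cylinder M m n c = G (restrict c {m..n})"
      by (simp add: cylinder_def G_def)
    show "restrict c {m..n} \<in> PiE {m..n} (\<lambda>_. insert None (Some ` edges M))"
      using that unfolding code_space_iff restrict_PiE_iff by blast
  qed
  then have "cylinder M m n ` {c \<in> code_space M. P c}
      \<subseteq> G ` (PiE {m..n} (\<lambda>_. insert None (Some ` edges M)))" by blast
  moreover have "countable (PiE {m..n} (\<lambda>_. insert None (Some ` edges M)))"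
    using E by (intro countable_PiE) auto
  ultimately have "countable (cylinder M m n ` {c \<in> code_space M. P c})"
    by (rule countable_subset[OF _ countable_image])
  then have "\<Union> (cylinder M m n ` {c \<in> code_space M. P c}) \<in> sets N"
    by (rule sets.countable_Union) (use cyl in blast)
  moreover have "\<Union> (cylinder M m n ` {c \<in> code_space M. P c}) = {\<sigma> \<in> code_space M. P \<sigma>}"
  proof (intro set_eqI iffI)
    fix \<sigma> assume "\<sigma> \<in> \<Union> (cylinder M m n ` {c \<in> code_space M. P c})"
    then obtain c where "c \<in> code_space M" "P c" "\<sigma> \<in> code_space M" "\<forall>k\<in>{m..n}. \<sigma> k = c k"
      by (auto simp: cylinder_def)
    then show "\<sigma> \<in> {\<sigma> \<in> code_space M. P \<sigma>}" using P[of c \<sigma>] by simp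
  qed (auto simp: cylinder_def)
  ultimately show ?thesis by simp
qed

lemma measurable_past_algebra_finite_window:
  assumes E: "countable (edges M)" and m: "m \<le> 0"
    and g: "\<And>\<sigma> \<tau>. \<sigma> \<in> code_space M \<Longrightarrow> \<tau> \<in> code_space M \<Longrightarrow>
              (\<And>k. m \<le> k \<Longrightarrow> k \<le> 0 \<Longrightarrow> \<sigma> k = \<tau> k) \<Longrightarrow> g \<sigma> = g \<tau>"
    and N: "space N = UNIV"
  shows "g \<in> measurable (past_algebra M) N"
proof (rule measurableI)
  fix V
  have "{\<sigma> \<in> code_space M. g \<sigma> \<in> V} \<in> sets (past_algebra M)"
  proof (rule finite_window_in_sets[where m = m and n = 0])
    show "g \<tau> \<in> V" if "\<sigma> \<in> code_space M" "\<tau> \<in> code_space M"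
      "\<And>k. m \<le> k \<Longrightarrow> k \<le> 0 \<Longrightarrow> \<sigma> k = \<tau> k" "g \<sigma> \<in> V" for \<sigma> \<tau>
      using that g[of \<sigma> \<tau>] by simp
  qed (use E m cylinder_in_past_algebra in auto)
  then show "g -` V \<inter> space (past_algebra M) \<in> sets (past_algebra M)"
    by (simp add: vimage_def Int_def conj_commute)
qed (simp add: N)

section \<open>The coding map and the shift\<close>

lemma cont_ext_props:
  fixes f :: "'a::metric_space \<Rightarrow> 'b::complete_space"
  assumes "uniformly_continuous_on S f"
  shows "continuous_on (closure S) (cont_ext S f)" "y \<in> S \<Longrightarrow> cont_ext S f y = f y"
proof -
  obtain g where "uniformly_continuous_on (closure S) g" "\<And>y. y \<in> S \<Longrightarrow> f y = g y"
    using uniformly_continuous_on_extension_on_closure[OF assms] by metis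
  then have "\<exists>g. continuous_on (closure S) g \<and> (\<forall>y\<in>S. g y = f y)"
    using uniformly_continuous_imp_continuous by force
  from someI_ex[OF this]
  show "continuous_on (closure S) (cont_ext S f)" "y \<in> S \<Longrightarrow> cont_ext S f y = f y"
    unfolding cont_ext_def by auto
qed

lemma w_comp_cong: "(\<And>k. - int n \<le> k \<Longrightarrow> k \<le> 0 \<Longrightarrow> \<sigma> k = \<tau> k) \<Longrightarrow> w_comp M \<sigma> n = w_comp M \<tau> n"
  by (induction n) auto

lemma coding_seq_cong:
  "(\<And>k. - int n \<le> k \<Longrightarrow> k \<le> 0 \<Longrightarrow> \<sigma> k = \<tau> k) \<Longrightarrow> coding_seq M x \<sigma> n = coding_seq M x \<tau> n"
  using w_comp_cong[of n \<sigma> \<tau> M] unfolding coding_seq_def by simp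

lemma w_comp_shift:
  "w_comp M (code_shift \<sigma>) (Suc n) = wmap_ext M (\<sigma> 1) \<circ> w_comp M \<sigma> n"
proof (induction n)
  case 0
  then show ?case by (simp add: code_shift_def)
next
  case (Suc n)
  have "w_comp M (code_shift \<sigma>) (Suc (Suc n))
      = w_comp M (code_shift \<sigma>) (Suc n) \<circ> wmap_ext M (code_shift \<sigma> (- int (Suc (Suc n))))"
    by (rule w_comp.simps(2))
  also have "code_shift \<sigma> (- int (Suc (Suc n))) = \<sigma> (- int (Suc n))"
    by (simp add: code_shift_def)
  finally have "w_comp M (code_shift \<sigma>) (Suc (Suc n))
      = (wmap_ext M (\<sigma> 1) \<circ> w_comp M \<sigma> n) \<circ> wmap_ext M (\<sigma> (- int (Suc n)))"
    unfolding Suc.IH .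
  then show ?case by (simp only: comp_assoc w_comp.simps(2))
qed

lemma coding_seq_shift:
  "coding_seq M x (code_shift \<sigma>) (Suc n) = wmap_ext M (\<sigma> 1) (coding_seq M x \<sigma> n)"
  unfolding coding_seq_def w_comp_shift by (simp add: code_shift_def)

text \<open>Membership in \<^const>\<open>coding_dom\<close> constrains all letters, including the future ones, so
  that set and \<^const>\<open>coding_map\<close> need not be measurable with respect to the past. Dropping the path condition
  gives versions that read only the letters at nonpositive times and agree with the
  originals on \<^const>\<open>coding_dom\<close>. The value \<^term>\<open>x 1\<close> outside is an arbitrary default.\<close>
definition past_dom :: "('k::metric_space, 'e) markov_system \<Rightarrow> (nat \<Rightarrow> 'k) \<Rightarrow> (int \<Rightarrow> 'e option) set" where
  "past_dom M x = {\<sigma> \<in> code_space M. Cauchy (coding_seq M x \<sigma>)}"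

definition past_map :: "('k::metric_space, 'e) markov_system \<Rightarrow> (nat \<Rightarrow> 'k) \<Rightarrow> (int \<Rightarrow> 'e option) \<Rightarrow> 'k" where
  "past_map M x \<sigma> = (if \<sigma> \<in> past_dom M x then lim (coding_seq M x \<sigma>) else x 1)"

locale coded_system =
  fixes M :: "('k::complete_space, 'e) markov_system" and x :: "nat \<Rightarrow> 'k"
  assumes cms: "countable_markov_system M"
    and uc: "unif_continuous M"
    and base: "\<And>j. j \<in> vertices M \<Longrightarrow> x j \<in> atom M j"
begin

lemma countable_edges: "countable (edges M)"
  using cms by (simp add: countable_markov_system_def)

lemma edge_props:
  assumes "e \<in> edges M"
  shows "src M e \<in> vertices M" "tgt M e \<in> vertices M"
    "wmap M e \<in> borel_measurable borel" "pmap M e \<in> borel_measurable borel"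
    "y \<in> atom M (src M e) \<Longrightarrow> wmap M e y \<in> atom M (tgt M e)"
    "pmap M e y \<ge> 0" "y \<notin> atom M (src M e) \<Longrightarrow> pmap M e y = 0"
proof -
  have "\<forall>e\<in>edges M. wmap M e \<in> borel_measurable borel \<and>
        wmap M e ` atom M (src M e) \<subseteq> atom M (tgt M e) \<and>
        pmap M e \<in> borel_measurable borel \<and>
        pmap M e ` atom M (src M e) \<subseteq> {0..1} \<and>
        (\<exists>y\<in>atom M (src M e). pmap M e y \<noteq> 0) \<and>
        (\<forall>y. y \<notin> atom M (src M e) \<longrightarrow> pmap M e y = 0)"
    and *: "src M ` edges M = vertices M" "tgt M ` edges M \<subseteq> vertices M"
    using cms unfolding countable_markov_system_def by - (elim conjE, assumption)+
  from bspec[OF this(1) assms]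
  have **: "wmap M e ` atom M (src M e) \<subseteq> atom M (tgt M e)" "pmap M e ` atom M (src M e) \<subseteq> {0..1}"
    "\<forall>y. y \<notin> atom M (src M e) \<longrightarrow> pmap M e y = 0"
    "wmap M e \<in> borel_measurable borel" "pmap M e \<in> borel_measurable borel"
    by - (elim conjE, assumption)+
  show "src M e \<in> vertices M" "tgt M e \<in> vertices M" using *(1,2) assms by auto
  show "wmap M e \<in> borel_measurable borel" "pmap M e \<in> borel_measurable borel" by fact+
  show "y \<in> atom M (src M e) \<Longrightarrow> wmap M e y \<in> atom M (tgt M e)" using **(1) by auto
  show "y \<notin> atom M (src M e) \<Longrightarrow> pmap M e y = 0" using **(3) by simp
  show "pmap M e y \<ge> 0"
    using **(2,3) by (cases "y \<in> atom M (src M e)") (auto simp: image_subset_iff)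
qed

lemma atom_borel: "j \<in> vertices M \<Longrightarrow> atom M j \<in> sets borel"
  using cms by (simp add: countable_markov_system_def)

lemma atoms_disjoint:
  "i \<in> vertices M \<Longrightarrow> j \<in> vertices M \<Longrightarrow> y \<in> atom M i \<Longrightarrow> y \<in> atom M j \<Longrightarrow> i = j"
proof -
  have "disjoint_family_on (atom M) (vertices M)"
    using cms by (simp add: countable_markov_system_def)
  then show "i \<in> vertices M \<Longrightarrow> j \<in> vertices M \<Longrightarrow> y \<in> atom M i \<Longrightarrow> y \<in> atom M j \<Longrightarrow> i = j"
    unfolding disjoint_family_on_def by blast
qed

lemma path_letterE:
  assumes "\<sigma> \<in> path_space M"
  obtains e where "e \<in> edges M" "\<sigma> k = Some e"
  using assms unfolding path_space_def by blast

lemma path_link: "\<sigma> \<in> path_space M \<Longrightarrow> src_ext M (\<sigma> (k + 1)) = tgt_ext M (\<sigma> k)"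
  unfolding path_space_def by blast

lemma path_vertices:
  assumes "\<sigma> \<in> path_space M"
  shows "src_ext M (\<sigma> k) \<in> vertices M" "tgt_ext M (\<sigma> k) \<in> vertices M"
proof -
  obtain e where "e \<in> edges M" "\<sigma> k = Some e" by (rule path_letterE[OF assms])
  then show "src_ext M (\<sigma> k) \<in> vertices M" "tgt_ext M (\<sigma> k) \<in> vertices M"
    using edge_props(1,2)[of e] by (simp_all add: src_ext_def tgt_ext_def)
qed

lemma w_comp_atom:
  assumes \<sigma>: "\<sigma> \<in> path_space M" and "y \<in> atom M (src_ext M (\<sigma> (- int n)))"
  shows "w_comp M \<sigma> n y \<in> atom M (tgt_ext M (\<sigma> 0))"
proof -
  have step: "wmap_ext M (\<sigma> k) z \<in> atom M (tgt_ext M (\<sigma> k))" if "z \<in> atom M (src_ext M (\<sigma> k))" for k z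
  proof -
    obtain e where "e \<in> edges M" "\<sigma> k = Some e" by (rule path_letterE[OF \<sigma>])
    then show ?thesis
      using edge_props(5)[of e z] that by (simp add: wmap_ext_def src_ext_def tgt_ext_def)
  qed
  show ?thesis using assms(2)
  proof (induction n arbitrary: y)
    case 0
    then show ?case using step by simp
  next
    case (Suc n)
    have "wmap_ext M (\<sigma> (- int (Suc n))) y \<in> atom M (src_ext M (\<sigma> (- int n)))"
      using step[OF Suc.prems] path_link[OF \<sigma>, of "- int (Suc n)"] by simp
    then show ?case using Suc.IH by simp
  qed
qed

lemma coding_seq_atom:
  assumes "\<sigma> \<in> path_space M"
  shows "coding_seq M x \<sigma> n \<in> atom M (tgt_ext M (\<sigma> 0))"
  unfolding coding_seq_def using assms path_vertices base by (intro w_comp_atom) auto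

lemma coding_dom_eq: "coding_dom M x = path_space M \<inter> past_dom M x"
  by (auto simp: coding_dom_def past_dom_def path_space_def Cauchy_convergent_iff)

lemma coding_map_eq_past_map: "\<sigma> \<in> coding_dom M x \<Longrightarrow> coding_map M x \<sigma> = past_map M x \<sigma>"
  by (simp add: coding_map_def past_map_def coding_dom_eq)

lemma tendsto_past_map:
  "\<sigma> \<in> past_dom M x \<Longrightarrow> coding_seq M x \<sigma> \<longlonglongrightarrow> past_map M x \<sigma>"
  by (simp add: past_map_def past_dom_def Cauchy_convergent_iff convergent_LIMSEQ_iff)

lemma past_map_closure:
  assumes "\<sigma> \<in> coding_dom M x"
  shows "past_map M x \<sigma> \<in> closure (atom M (tgt_ext M (\<sigma> 0)))"
  using assms coding_seq_atom tendsto_past_map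
  unfolding closure_sequential coding_dom_eq by (intro exI[of _ "coding_seq M x \<sigma>"]) auto

abbreviation wbar :: "'e \<Rightarrow> 'k \<Rightarrow> 'k" where
  "wbar e \<equiv> cont_ext (atom M (src M e)) (wmap M e)"

lemma wbar_props:
  assumes "e \<in> edges M"
  shows "continuous_on (closure (atom M (src M e))) (wbar e)"
    "y \<in> atom M (src M e) \<Longrightarrow> wbar e y = wmap M e y"
  using cont_ext_props[of "atom M (src M e)" "wmap M e"] uc assms
  by (auto simp: unif_continuous_def)

text \<open>The coding map intertwines the shift with the extended maps: prolonging the past by an edge
  \<^term>\<open>e\<close> applies \<^term>\<open>wmap M e\<close> to each approximant, and these lie in the atom where \<^term>\<open>e\<close>
  starts, so that continuity of the extension up to the closure passes this to the limit.\<close>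
lemma coding_dom_shift:
  assumes \<sigma>: "\<sigma> \<in> coding_dom M x" and e: "\<sigma> 1 = Some e"
  shows "code_shift \<sigma> \<in> coding_dom M x" "past_map M x (code_shift \<sigma>) = wbar e (past_map M x \<sigma>)"
    "tgt_ext M (\<sigma> 0) = src M e" "e \<in> edges M"
proof -
  have path: "\<sigma> \<in> path_space M" and "\<sigma> \<in> past_dom M x" using \<sigma> by (auto simp: coding_dom_eq)
  have path': "code_shift \<sigma> \<in> path_space M"
  proof -
    have "code_shift \<sigma> n \<in> Some ` edges M" "src_ext M (code_shift \<sigma> (n + 1)) = tgt_ext M (code_shift \<sigma> n)" for n
      using path path_link[OF path, of "n + 1"] unfolding path_space_def code_shift_def by blast+
    moreover have "code_shift \<sigma> \<in> code_space M" using path by (simp add: path_space_def)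
    ultimately show ?thesis unfolding path_space_def by blast
  qed
  show e': "e \<in> edges M" by (rule path_letterE[OF path, of 1]) (use e in simp)
  show src: "tgt_ext M (\<sigma> 0) = src M e" using path_link[OF path, of 0] e by (simp add: src_ext_def)
  have lim: "coding_seq M x \<sigma> \<longlonglongrightarrow> past_map M x \<sigma>" by (rule tendsto_past_map) fact
  have "(\<lambda>n. wbar e (coding_seq M x \<sigma> n)) \<longlonglongrightarrow> wbar e (past_map M x \<sigma>)"
  proof (rule continuous_on_tendsto_compose[OF wbar_props(1)[OF e'] lim])
    show "past_map M x \<sigma> \<in> closure (atom M (src M e))" using past_map_closure[OF \<sigma>] src by simp
    show "\<forall>\<^sub>F n in sequentially. coding_seq M x \<sigma> n \<in> closure (atom M (src M e))"
      using coding_seq_atom[OF path] src closure_subset by (intro always_eventually) auto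
  qed
  moreover have "wbar e (coding_seq M x \<sigma> n) = coding_seq M x (code_shift \<sigma>) (Suc n)" for n
    using wbar_props(2)[OF e'] coding_seq_atom[OF path, of n] src e
    by (simp add: coding_seq_shift wmap_ext_def)
  ultimately have "(\<lambda>n. coding_seq M x (code_shift \<sigma>) (Suc n)) \<longlonglongrightarrow> wbar e (past_map M x \<sigma>)"
    by simp
  then have lim': "coding_seq M x (code_shift \<sigma>) \<longlonglongrightarrow> wbar e (past_map M x \<sigma>)"
    by (rule LIMSEQ_imp_Suc)
  then show dom': "code_shift \<sigma> \<in> coding_dom M x"
    using path' by (auto simp: coding_dom_def convergent_def)
  show "past_map M x (code_shift \<sigma>) = wbar e (past_map M x \<sigma>)"
    using LIMSEQ_unique[OF tendsto_past_map lim'] dom' by (simp add: coding_dom_eq)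
qed

subsection \<open>Measurability\<close>

lemma measurable_past_letter: "k \<le> 0 \<Longrightarrow> (\<lambda>\<sigma>. \<sigma> k) \<in> measurable (past_algebra M) (count_space UNIV)"
  by (rule measurable_past_algebra_finite_window[OF countable_edges, of k]) auto

text \<open>An approximant is a function of finitely many letters, hence constant on each of countably many
  cylinders. This gives measurability of it, and below of distances between two of
  them, for a state space that may fail to be separable.\<close>
lemma measurable_past_coding_seq: "(\<lambda>\<sigma>. coding_seq M x \<sigma> n) \<in> measurable (past_algebra M) borel"
  by (rule measurable_past_algebra_finite_window[OF countable_edges, of "- int n"])
    (auto intro: coding_seq_cong)

lemma past_dom_sets: "past_dom M x \<in> sets (past_algebra M)"
proof -
  have [measurable]: "Measurable.pred (past_algebra M) (\<lambda>\<sigma>. dist (coding_seq M x \<sigma> m) (coding_seq M x \<sigma> n) < c)"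
    for m n c
  proof (rule measurable_past_algebra_finite_window[OF countable_edges, of "- int (max m n)"])
    fix \<sigma> \<tau> :: "int \<Rightarrow> 'e option"
    assume *: "\<And>k. - int (max m n) \<le> k \<Longrightarrow> k \<le> 0 \<Longrightarrow> \<sigma> k = \<tau> k"
    have "coding_seq M x \<sigma> m = coding_seq M x \<tau> m" "coding_seq M x \<sigma> n = coding_seq M x \<tau> n"
      by (rule coding_seq_cong; use * in simp)+
    then show "(dist (coding_seq M x \<sigma> m) (coding_seq M x \<sigma> n) < c)
        = (dist (coding_seq M x \<tau> m) (coding_seq M x \<tau> n) < c)" by simp
  qed auto
  have "{\<sigma> \<in> space (past_algebra M). Cauchy (coding_seq M x \<sigma>)} \<in> sets (past_algebra M)"
    unfolding metric_Cauchy_iff2 by measurable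
  then show ?thesis by (simp add: past_dom_def)
qed

lemma measurable_past_map: "past_map M x \<in> measurable (past_algebra M) borel"
proof (rule borel_measurable_LIMSEQ_metric)
  show "(\<lambda>\<sigma>. if \<sigma> \<in> past_dom M x then coding_seq M x \<sigma> n else x 1) \<in> measurable (past_algebra M) borel" for n
    by (intro measurable_If_set measurable_past_coding_seq measurable_const sets.Int sets.top past_dom_sets) simp
  show "(\<lambda>n. if \<sigma> \<in> past_dom M x then coding_seq M x \<sigma> n else x 1) \<longlonglongrightarrow> past_map M x \<sigma>" for \<sigma>
    using tendsto_past_map[of \<sigma>] by (cases "\<sigma> \<in> past_dom M x") (auto simp: past_map_def)
qed

lemma measurable_past_imp_code_borel:
  "g \<in> measurable (past_algebra M) N \<Longrightarrow> g \<in> measurable (code_borel M) N"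
  by (rule measurable_from_subalg[OF subalgebra_past_algebra]) simp

lemma coding_dom_sets: "coding_dom M x \<in> sets (code_borel M)"
proof -
  have [measurable]: "Measurable.pred (code_borel M) (\<lambda>\<sigma>. \<sigma> n \<in> Some ` edges M \<and> src_ext M (\<sigma> (n + 1)) = tgt_ext M (\<sigma> n))" for n
    unfolding pred_def space_code_borel
    by (rule finite_window_in_sets[OF countable_edges cylinder_in_code_borel, of n "n + 1"]) auto
  have "{\<sigma> \<in> space (code_borel M). \<forall>n. \<sigma> n \<in> Some ` edges M \<and> src_ext M (\<sigma> (n + 1)) = tgt_ext M (\<sigma> n)} \<in> sets (code_borel M)"
    by measurable
  moreover have "past_dom M x \<in> sets (code_borel M)"
    using past_dom_sets subalgebra_past_algebra[of "code_borel M" M] by (auto simp: subalgebra_def)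
  ultimately show ?thesis unfolding coding_dom_eq path_space_def by auto
qed

lemma measurable_coding_map: "coding_map M x \<in> measurable (code_borel M) borel"
proof -
  have "(\<lambda>\<sigma>. if \<sigma> \<in> coding_dom M x then past_map M x \<sigma> else x (tgt_ext M (\<sigma> 0))) \<in> measurable (code_borel M) borel"
    using coding_dom_sets measurable_compose[OF measurable_past_letter[of 0], of "\<lambda>a. x (tgt_ext M a)" borel]
    by (intro measurable_If_set measurable_past_imp_code_borel measurable_past_map sets.Int sets.top) auto
  moreover have "coding_map M x = (\<lambda>\<sigma>. if \<sigma> \<in> coding_dom M x then past_map M x \<sigma> else x (tgt_ext M (\<sigma> 0)))"
    using coding_map_eq_past_map by (auto simp: coding_map_def)
  ultimately show ?thesis by simp
qed

section \<open>Weights, operators and the one-step identity\<close>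

lemma pmap_cont_ext:
  assumes "e \<in> edges M"
  shows "continuous_on (closure (atom M (src M e))) (cont_ext (atom M (src M e)) (pmap M e))"
    "y \<in> atom M (src M e) \<Longrightarrow> cont_ext (atom M (src M e)) (pmap M e) y = pmap M e y"
  using cont_ext_props[of "atom M (src M e)" "pmap M e"] uc assms
  by (auto simp: unif_continuous_def)

lemma pbar_eq_pmap: "e \<in> edges M \<Longrightarrow> y \<in> atom M (src M e) \<Longrightarrow> pbar M e y = pmap M e y"
  using closure_subset[of "atom M (src M e)"] by (auto simp: pbar_def pmap_cont_ext)

lemma pbar_nonneg: "e \<in> edges M \<Longrightarrow> pbar M e y \<ge> 0"
proof (cases "y \<in> closure (atom M (src M e))")
  case True
  assume e: "e \<in> edges M"
  have "cont_ext (atom M (src M e)) (pmap M e) y \<ge> 0"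
    by (rule continuous_ge_on_closure[OF pmap_cont_ext(1)[OF e] True])
      (simp add: pmap_cont_ext(2)[OF e] edge_props(6)[OF e])
  then show ?thesis by (simp add: pbar_def)
qed (simp add: pbar_def)

lemma pbdry_nonneg: "e \<in> edges M \<Longrightarrow> pbdry M e y \<ge> 0"
  by (simp add: pbdry_def pbar_nonneg)

lemma pbdry_eq_pbar: "y \<notin> atom M (src M e) \<Longrightarrow> pbdry M e y = pbar M e y"
  by (simp add: pbdry_def pbar_def indicator_def)

lemma pbdry_eq_0: "y \<in> atom M (src M e) \<Longrightarrow> pbdry M e y = 0"
  by (simp add: pbdry_def)

lemma measurable_pbar: "e \<in> edges M \<Longrightarrow> pbar M e \<in> borel_measurable borel"
  unfolding pbar_def[abs_def]
  by (intro borel_measurable_continuous_on_if pmap_cont_ext(1)) auto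

lemma measurable_pbdry:
  assumes "e \<in> edges M"
  shows "pbdry M e \<in> borel_measurable borel"
proof -
  have "closure (atom M (src M e)) - atom M (src M e) \<in> sets borel"
    by (rule sets.Diff[OF borel_closed atom_borel]) (use edge_props(1)[OF assms] in simp_all)
  then show ?thesis
    unfolding pbdry_def[abs_def]
    by (intro borel_measurable_times measurable_pbar borel_measurable_indicator assms)
qed

lemma is_wbar_exists: "\<exists>wb. is_wbar M wb"
proof
  let ?wb = "\<lambda>e y. if y \<in> closure (atom M (src M e)) then wbar e y else x 1"
  have "?wb e \<in> borel_measurable borel" if "e \<in> edges M" for e
    by (intro borel_measurable_continuous_on_if wbar_props that) auto
  then show "is_wbar M ?wb" unfolding is_wbar_def by simp
qed

lemma is_wbar_eq:
  assumes "is_wbar M wb" "e \<in> edges M"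
  shows "wb e \<in> borel_measurable borel"
    "y \<in> closure (atom M (src M e)) \<Longrightarrow> wb e y = wbar e y"
    "y \<in> atom M (src M e) \<Longrightarrow> wb e y = wmap M e y"
  using assms wbar_props(2)[OF assms(2)] closure_subset[of "atom M (src M e)"]
  by (auto simp: is_wbar_def)

lemma markov_op_eq_nn_integral:
  "markov_op M f y = (\<integral>\<^sup>+e. ennreal (pmap M e y) * f (wmap M e y) \<partial>count_space (edges M))"
  by (simp add: markov_op_def infsum_ennreal_eq_nn_integral countable_edges)

lemma bdry_op_eq_nn_integral:
  "bdry_op M wb f y = (\<integral>\<^sup>+e. ennreal (pbdry M e y) * f (wb e y) \<partial>count_space (edges M))"
  by (simp add: bdry_op_def infsum_ennreal_eq_nn_integral countable_edges)

lemma measurable_markov_op: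
  assumes "f \<in> borel_measurable borel"
  shows "markov_op M f \<in> borel_measurable borel"
  unfolding markov_op_eq_nn_integral[abs_def]
  by (intro borel_measurable_count_space_integral countable_edges borel_measurable_times_ennreal
      measurable_compose[OF _ measurable_ennreal] measurable_compose[OF _ assms] edge_props)

lemma measurable_bdry_op:
  assumes "f \<in> borel_measurable borel" "is_wbar M wb"
  shows "bdry_op M wb f \<in> borel_measurable borel"
  unfolding bdry_op_eq_nn_integral[abs_def]
  by (intro borel_measurable_count_space_integral countable_edges borel_measurable_times_ennreal
      measurable_compose[OF _ measurable_ennreal] measurable_compose[OF _ assms(1)] measurable_pbdry
      is_wbar_eq(1) assms)

text \<open>Among the edges, only those that start in the atom of the given point can have positive weight, and their
  weights add up to 1.\<close>
lemma markov_op_const: "markov_op M (\<lambda>_. c) y = c"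
proof -
  have "(\<Union>j\<in>vertices M. atom M j) = UNIV"
    and sum1: "\<forall>j\<in>vertices M. \<forall>y\<in>atom M j. ((\<lambda>e. pmap M e y) has_sum 1) {e \<in> edges M. src M e = j}"
    using cms unfolding countable_markov_system_def by - (elim conjE, assumption)+
  then obtain j where j: "j \<in> vertices M" "y \<in> atom M j" by blast
  have "markov_op M (\<lambda>_. c) y = (\<integral>\<^sup>+e. ennreal (pmap M e y) * c \<partial>count_space (edges M))"
    by (rule markov_op_eq_nn_integral)
  also have "\<dots> = (\<integral>\<^sup>+e. ennreal (pmap M e y) \<partial>count_space (edges M)) * c"
    by (simp add: nn_integral_multc)
  also have "(\<integral>\<^sup>+e. ennreal (pmap M e y) \<partial>count_space (edges M))
      = (\<integral>\<^sup>+e. ennreal (pmap M e y) \<partial>count_space {e \<in> edges M. src M e = j})"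
    using atoms_disjoint[OF j(1) _ j(2)] edge_props(1,7) by (intro nn_integral_count_space_eq) force+
  also have "\<dots> = ennreal 1"
    using sum1 j countable_edges edge_props(6)
    by (intro has_sum_nn_integral_count_space) (auto elim: countable_subset[rotated])
  finally show ?thesis by simp
qed

text \<open>A representative, measurable in the past, of the conditional probability that the next letter
  is \<^term>\<open>e\<close>; \<open>path_op\<close> then averages over the next letter.\<close>
definition path_weight :: "('e \<Rightarrow> 'k \<Rightarrow> real) \<Rightarrow> 'e \<Rightarrow> (int \<Rightarrow> 'e option) \<Rightarrow> real" where
  "path_weight q e \<sigma> = q e (past_map M x \<sigma>) * of_bool (tgt_ext M (\<sigma> 0) = src M e)"

definition path_op ::
    "('e \<Rightarrow> 'k \<Rightarrow> real) \<Rightarrow> ('e \<Rightarrow> 'k \<Rightarrow> 'k) \<Rightarrow> ('k \<Rightarrow> ennreal) \<Rightarrow> (int \<Rightarrow> 'e option) \<Rightarrow> ennreal" where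
  "path_op q wb f \<sigma> =
     (\<integral>\<^sup>+e. ennreal (path_weight q e \<sigma>) * f (wb e (past_map M x \<sigma>)) \<partial>count_space (edges M))"

lemma measurable_path_weight:
  assumes "q e \<in> borel_measurable borel"
  shows "path_weight q e \<in> borel_measurable (past_algebra M)"
  unfolding path_weight_def[abs_def]
  by (intro borel_measurable_times measurable_compose[OF measurable_past_map assms]
      measurable_compose[OF measurable_past_letter[of 0], of "\<lambda>a. of_bool (tgt_ext M a = src M e)"]) auto

lemma measurable_path_op:
  assumes "\<And>e. e \<in> edges M \<Longrightarrow> q e \<in> borel_measurable borel"
    and "is_wbar M wb" and f: "f \<in> borel_measurable borel"
  shows "path_op q wb f \<in> borel_measurable (past_algebra M)"
  unfolding path_op_def[abs_def]
  by (intro borel_measurable_count_space_integral countable_edges borel_measurable_times_ennreal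
      measurable_compose[OF measurable_path_weight measurable_ennreal]
      measurable_compose[OF _ f] measurable_compose[OF measurable_past_map] is_wbar_eq(1) assms)

lemma shift_invariant_props:
  assumes "\<Lambda> \<in> shift_invariant_measures M"
  shows "prob_space \<Lambda>" "sets \<Lambda> = sets (code_borel M)" "space \<Lambda> = code_space M"
    "distr \<Lambda> (code_borel M) code_shift = \<Lambda>" "code_shift \<in> measurable \<Lambda> (code_borel M)"
    "subalgebra \<Lambda> (past_algebra M)"
proof -
  show s: "sets \<Lambda> = sets (code_borel M)" and "prob_space \<Lambda>" "distr \<Lambda> (code_borel M) code_shift = \<Lambda>"
    using assms unfolding shift_invariant_measures_def by blast+
  show "space \<Lambda> = code_space M" using sets_eq_imp_space_eq[OF s] by simp
  show "code_shift \<in> measurable \<Lambda> (code_borel M)"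
    using measurable_code_shift s measurable_cong_sets by blast
  show "subalgebra \<Lambda> (past_algebra M)" by (rule subalgebra_past_algebra[OF s])
qed

lemma nn_integral_shift:
  assumes \<Lambda>: "\<Lambda> \<in> shift_invariant_measures M" and h: "h \<in> borel_measurable (code_borel M)"
  shows "(\<integral>\<^sup>+\<sigma>. h (code_shift \<sigma>) \<partial>\<Lambda>) = (\<integral>\<^sup>+\<sigma>. h \<sigma> \<partial>\<Lambda>)"
  using nn_integral_distr[OF shift_invariant_props(5)[OF \<Lambda>], of h] h
  unfolding shift_invariant_props(4)[OF \<Lambda>] by (simp cong: measurable_cong_sets add: shift_invariant_props(2)[OF \<Lambda>])

lemma AE_coding_dom:
  assumes \<Lambda>: "\<Lambda> \<in> shift_invariant_measures M" and "emeasure \<Lambda> (coding_dom M x) = 1"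
  shows "AE \<sigma> in \<Lambda>. \<sigma> \<in> coding_dom M x"
proof -
  interpret prob_space \<Lambda> by (rule shift_invariant_props(1)[OF \<Lambda>])
  show ?thesis
    using assms(2) coding_dom_sets shift_invariant_props(2)[OF \<Lambda>]
    by (intro AE_prob_1) (simp add: measure_def)
qed

text \<open>On \<^const>\<open>coding_dom\<close>, a set of full measure, the past versions equal the functions in the definition of
  \<^const>\<open>states_with_weight\<close>, so the almost sure identity of conditional expectations can be tested with them.\<close>
lemma states_with_weight_iff:
  assumes q: "\<And>e. e \<in> edges M \<Longrightarrow> q e \<in> borel_measurable borel"
    and q0: "\<And>e y. e \<in> edges M \<Longrightarrow> q e y \<ge> 0"
  shows "\<Lambda> \<in> states_with_weight M x q \<longleftrightarrow>
    \<Lambda> \<in> shift_invariant_measures M \<and> emeasure \<Lambda> (coding_dom M x) = 1 \<and>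
    (\<forall>e\<in>edges M. \<forall>g\<in>borel_measurable (past_algebra M).
       (\<integral>\<^sup>+\<sigma>. g \<sigma> * indicator (cylinder M 1 1 (\<lambda>_. Some e)) \<sigma> \<partial>\<Lambda>)
       = (\<integral>\<^sup>+\<sigma>. g \<sigma> * ennreal (path_weight q e \<sigma>) \<partial>\<Lambda>))"
proof -
  have "(AE \<sigma> in \<Lambda>. real_cond_exp \<Lambda> (past_algebra M) (indicator (cylinder M 1 1 (\<lambda>_. Some e))) \<sigma> =
           q e (coding_map M x \<sigma>) * indicator (paths_ending_at M (src M e)) \<sigma>) \<longleftrightarrow>
     (\<forall>g\<in>borel_measurable (past_algebra M).
       (\<integral>\<^sup>+\<sigma>. g \<sigma> * indicator (cylinder M 1 1 (\<lambda>_. Some e)) \<sigma> \<partial>\<Lambda>)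
       = (\<integral>\<^sup>+\<sigma>. g \<sigma> * ennreal (path_weight q e \<sigma>) \<partial>\<Lambda>))" (is "?l = ?r")
    if \<Lambda>: "\<Lambda> \<in> shift_invariant_measures M" and dom: "emeasure \<Lambda> (coding_dom M x) = 1" and e: "e \<in> edges M" for e
  proof -
    have eq: "q e (coding_map M x \<sigma>) * indicator (paths_ending_at M (src M e)) \<sigma> = path_weight q e \<sigma>"
      if "\<sigma> \<in> coding_dom M x" for \<sigma>
      using that coding_map_eq_past_map[OF that]
      by (simp add: path_weight_def indicator_def paths_ending_at_def coding_dom_def)
    have "?l \<longleftrightarrow> (AE \<sigma> in \<Lambda>. real_cond_exp \<Lambda> (past_algebra M) (indicator (cylinder M 1 1 (\<lambda>_. Some e))) \<sigma>
        = path_weight q e \<sigma>)"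
    proof
      assume ?l
      then show "AE \<sigma> in \<Lambda>. real_cond_exp \<Lambda> (past_algebra M) (indicator (cylinder M 1 1 (\<lambda>_. Some e))) \<sigma>
        = path_weight q e \<sigma>"
        using AE_coding_dom[OF \<Lambda> dom] by eventually_elim (simp add: eq)
    next
      assume "AE \<sigma> in \<Lambda>. real_cond_exp \<Lambda> (past_algebra M) (indicator (cylinder M 1 1 (\<lambda>_. Some e))) \<sigma>
        = path_weight q e \<sigma>"
      then show ?l
        using AE_coding_dom[OF \<Lambda> dom] by eventually_elim (simp add: eq)
    qed
    also have "\<dots> \<longleftrightarrow> ?r"
    proof (rule cond_exp_indicator_iff_nn_integral)
      show "cylinder M 1 1 (\<lambda>_. Some e) \<in> sets \<Lambda>"
        unfolding shift_invariant_props(2)[OF \<Lambda>] by (rule cylinder_in_code_borel)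
      show "path_weight q e \<sigma> \<ge> 0" for \<sigma> using q0[OF e] by (simp add: path_weight_def)
    qed (intro shift_invariant_props[OF \<Lambda>] measurable_path_weight q[OF e])+
    finally show ?thesis .
  qed
  then show ?thesis unfolding states_with_weight_def by blast
qed

lemma states_with_weight_integral:
  assumes q: "\<And>e. e \<in> edges M \<Longrightarrow> q e \<in> borel_measurable borel"
    and q0: "\<And>e y. e \<in> edges M \<Longrightarrow> q e y \<ge> 0"
    and "\<Lambda> \<in> states_with_weight M x q" "e \<in> edges M" "g \<in> borel_measurable (past_algebra M)"
  shows "(\<integral>\<^sup>+\<sigma>. g \<sigma> * indicator (cylinder M 1 1 (\<lambda>_. Some e)) \<sigma> \<partial>\<Lambda>)
    = (\<integral>\<^sup>+\<sigma>. g \<sigma> * ennreal (path_weight q e \<sigma>) \<partial>\<Lambda>)"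
  using states_with_weight_iff[of q \<Lambda>, OF q q0] assms(3-5) by blast

text \<open>The Markov property of the coded process. Almost surely exactly one cylinder \<^term>\<open>cylinder M 1 1 (\<lambda>_. Some e)\<close>
  contains the path, and on it the shifted path is coded by the image under \<^term>\<open>wb e\<close> of the
  point that codes the path. Summing over \<^term>\<open>e\<close> and replacing the indicator of each cylinder by its conditional
  probability gives the identity.\<close>
lemma one_step_identity:
  assumes q: "\<And>e. e \<in> edges M \<Longrightarrow> q e \<in> borel_measurable borel"
    and q0: "\<And>e y. e \<in> edges M \<Longrightarrow> q e y \<ge> 0"
    and \<Lambda>: "\<Lambda> \<in> states_with_weight M x q" and wb: "is_wbar M wb"
    and f: "f \<in> borel_measurable borel" and g: "g \<in> borel_measurable (past_algebra M)"
  shows "(\<integral>\<^sup>+\<sigma>. g \<sigma> * f (past_map M x (code_shift \<sigma>)) \<partial>\<Lambda>) = (\<integral>\<^sup>+\<sigma>. g \<sigma> * path_op q wb f \<sigma> \<partial>\<Lambda>)"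
proof -
  have inv: "\<Lambda> \<in> shift_invariant_measures M" and dom: "emeasure \<Lambda> (coding_dom M x) = 1"
    using \<Lambda> by (simp_all add: states_with_weight_def)
  note props = shift_invariant_props[OF inv]
  let ?C = "\<lambda>e. cylinder M 1 1 (\<lambda>_. Some e)"
  have fw: "(\<lambda>\<sigma>. g \<sigma> * f (wb e (past_map M x \<sigma>))) \<in> borel_measurable (past_algebra M)" if "e \<in> edges M" for e
    by (intro borel_measurable_times_ennreal g measurable_compose[OF _ f]
        measurable_compose[OF measurable_past_map] is_wbar_eq(1)[OF wb that])
  have pw: "(\<lambda>\<sigma>. ennreal (path_weight q e \<sigma>)) \<in> borel_measurable (past_algebra M)" if "e \<in> edges M" for e
    by (rule measurable_compose[OF measurable_path_weight[of q, OF q[OF that]] measurable_ennreal])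
  have ind: "(\<lambda>\<sigma>. indicator (?C e) \<sigma> :: ennreal) \<in> borel_measurable \<Lambda>" for e
    using cylinder_in_code_borel[of M 1 1 "\<lambda>_. Some e"] props(2)
    by (intro borel_measurable_indicator) simp
  \<comment> \<open>The sum has a single nonzero term, the one for the letter at time 1.\<close>
  have ptw: "AE \<sigma> in \<Lambda>. g \<sigma> * f (past_map M x (code_shift \<sigma>))
      = (\<integral>\<^sup>+e. g \<sigma> * f (wb e (past_map M x \<sigma>)) * indicator (?C e) \<sigma> \<partial>count_space (edges M))"
    using AE_coding_dom[OF inv dom]
  proof eventually_elim
    case (elim \<sigma>)
    then have path: "\<sigma> \<in> path_space M" "\<sigma> \<in> code_space M" by (auto simp: coding_dom_def path_space_def)
    obtain e0 where e0: "e0 \<in> edges M" "\<sigma> 1 = Some e0" by (rule path_letterE[OF path(1)])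
    note shift = coding_dom_shift[OF elim e0(2)]
    have "past_map M x \<sigma> \<in> closure (atom M (src M e0))"
      using past_map_closure[OF elim] shift(3) by simp
    then have "wb e0 (past_map M x \<sigma>) = past_map M x (code_shift \<sigma>)"
      using shift(2) is_wbar_eq(2)[OF wb e0(1)] by simp
    moreover have "indicator (?C e) \<sigma> = (indicator {e0} e :: ennreal)" for e
      using e0(2) path(2) by (simp add: cylinder_def indicator_def)
    ultimately have "(\<integral>\<^sup>+e. g \<sigma> * f (wb e (past_map M x \<sigma>)) * indicator (?C e) \<sigma> \<partial>count_space (edges M))
        = (\<integral>\<^sup>+e. g \<sigma> * f (past_map M x (code_shift \<sigma>)) * indicator {e0} e \<partial>count_space (edges M))"
      by (intro nn_integral_cong) (simp add: indicator_def)
    also have "\<dots> = g \<sigma> * f (past_map M x (code_shift \<sigma>))"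
      using e0(1) by (subst nn_integral_cmult_indicator) auto
    finally show ?case ..
  qed
  have "(\<integral>\<^sup>+\<sigma>. g \<sigma> * f (past_map M x (code_shift \<sigma>)) \<partial>\<Lambda>)
      = (\<integral>\<^sup>+\<sigma>. \<integral>\<^sup>+e. g \<sigma> * f (wb e (past_map M x \<sigma>)) * indicator (?C e) \<sigma> \<partial>count_space (edges M) \<partial>\<Lambda>)"
    by (rule nn_integral_cong_AE[OF ptw])
  also have "\<dots> = (\<integral>\<^sup>+e. \<integral>\<^sup>+\<sigma>. g \<sigma> * f (wb e (past_map M x \<sigma>)) * indicator (?C e) \<sigma> \<partial>\<Lambda> \<partial>count_space (edges M))"
    by (intro nn_integral_count_space_nn_integral countable_edges borel_measurable_times_ennreal ind
        measurable_from_subalg[OF props(6) fw])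
  also have "\<dots> = (\<integral>\<^sup>+e. \<integral>\<^sup>+\<sigma>. g \<sigma> * f (wb e (past_map M x \<sigma>)) * ennreal (path_weight q e \<sigma>) \<partial>\<Lambda> \<partial>count_space (edges M))"
    by (intro nn_integral_cong states_with_weight_integral[OF q q0 \<Lambda>] fw) simp_all
  also have "\<dots> = (\<integral>\<^sup>+\<sigma>. \<integral>\<^sup>+e. g \<sigma> * f (wb e (past_map M x \<sigma>)) * ennreal (path_weight q e \<sigma>) \<partial>count_space (edges M) \<partial>\<Lambda>)"
    by (intro nn_integral_count_space_nn_integral[symmetric] countable_edges borel_measurable_times_ennreal
        measurable_from_subalg[OF props(6) fw] measurable_from_subalg[OF props(6) pw])
  also have "\<dots> = (\<integral>\<^sup>+\<sigma>. g \<sigma> * path_op q wb f \<sigma> \<partial>\<Lambda>)"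
  proof (rule nn_integral_cong)
    fix \<sigma>
    have "(\<integral>\<^sup>+e. g \<sigma> * f (wb e (past_map M x \<sigma>)) * ennreal (path_weight q e \<sigma>) \<partial>count_space (edges M))
       = (\<integral>\<^sup>+e. g \<sigma> * (ennreal (path_weight q e \<sigma>) * f (wb e (past_map M x \<sigma>))) \<partial>count_space (edges M))"
      by (intro nn_integral_cong) (simp add: ac_simps)
    then show "(\<integral>\<^sup>+e. g \<sigma> * f (wb e (past_map M x \<sigma>)) * ennreal (path_weight q e \<sigma>) \<partial>count_space (edges M))
       = g \<sigma> * path_op q wb f \<sigma>"
      by (simp add: path_op_def nn_integral_cmult)
  qed
  finally show ?thesis .
qed

text \<open>By invariance the lower bound on \<^term>\<open>f\<close> also holds along the shifted path. Testing the one-step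
  identity on the set where the conditional mean is below 1, which belongs to the past, forces
  this set to be null. With \<^term>\<open>f = (\<lambda>_. 1)\<close> this says that the weights have total mass at least 1.\<close>
lemma path_op_ge_1:
  assumes q: "\<And>e. e \<in> edges M \<Longrightarrow> q e \<in> borel_measurable borel"
    and q0: "\<And>e y. e \<in> edges M \<Longrightarrow> q e y \<ge> 0"
    and \<Lambda>: "\<Lambda> \<in> states_with_weight M x q" and wb: "is_wbar M wb"
    and f: "f \<in> borel_measurable borel" and f1: "AE \<sigma> in \<Lambda>. f (past_map M x \<sigma>) \<ge> 1"
  shows "AE \<sigma> in \<Lambda>. path_op q wb f \<sigma> \<ge> 1"
proof -
  have inv: "\<Lambda> \<in> shift_invariant_measures M" using \<Lambda> by (simp add: states_with_weight_def)
  note props = shift_invariant_props[OF inv]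
  interpret prob_space \<Lambda> by (rule props(1))
  define X where "X = {\<sigma> \<in> space (past_algebra M). path_op q wb f \<sigma> < 1}"
  have X: "X \<in> sets (past_algebra M)"
    unfolding X_def by (intro borel_measurable_less measurable_path_op q wb f measurable_const) auto
  have X': "X \<in> sets \<Lambda>" using X props(6) by (auto simp: subalgebra_def)
  have iX: "(indicator X :: _ \<Rightarrow> ennreal) \<in> borel_measurable (past_algebra M)"
    using X by (rule borel_measurable_indicator)
  have po: "path_op q wb f \<in> borel_measurable \<Lambda>"
    by (rule measurable_from_subalg[OF props(6) measurable_path_op[OF q wb f]])
  have "AE \<sigma> in distr \<Lambda> (code_borel M) code_shift. f (past_map M x \<sigma>) \<ge> 1"
    using f1 unfolding props(4) .
  then have "AE \<sigma> in \<Lambda>. f (past_map M x (code_shift \<sigma>)) \<ge> 1"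
    by (rule AE_distrD[OF props(5)])
  then have "(\<integral>\<^sup>+\<sigma>. indicator X \<sigma> \<partial>\<Lambda>) \<le> (\<integral>\<^sup>+\<sigma>. indicator X \<sigma> * f (past_map M x (code_shift \<sigma>)) \<partial>\<Lambda>)"
    by (intro nn_integral_mono_AE, eventually_elim) (simp add: indicator_def)
  also have "\<dots> = (\<integral>\<^sup>+\<sigma>. indicator X \<sigma> * path_op q wb f \<sigma> \<partial>\<Lambda>)"
    by (rule one_step_identity[OF q q0 \<Lambda> wb f iX])
  finally have le: "(\<integral>\<^sup>+\<sigma>. indicator X \<sigma> \<partial>\<Lambda>) \<le> (\<integral>\<^sup>+\<sigma>. indicator X \<sigma> * path_op q wb f \<sigma> \<partial>\<Lambda>)" .
  have leX: "indicator X \<sigma> * path_op q wb f \<sigma> \<le> indicator X \<sigma>" for \<sigma>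
    by (auto simp: X_def indicator_def)
  have "AE \<sigma> in \<Lambda>. indicator X \<sigma> \<le> indicator X \<sigma> * path_op q wb f \<sigma>"
  proof (rule ccontr)
    assume neg: "\<not> ?thesis"
    have fin: "(\<integral>\<^sup>+\<sigma>. indicator X \<sigma> * path_op q wb f \<sigma> \<partial>\<Lambda>) \<noteq> \<infinity>"
      using nn_integral_mono[of \<Lambda> "\<lambda>\<sigma>. indicator X \<sigma> * path_op q wb f \<sigma>" "indicator X"] leX X'
      by (auto simp: top_unique)
    have "(\<integral>\<^sup>+\<sigma>. indicator X \<sigma> * path_op q wb f \<sigma> \<partial>\<Lambda>) < (\<integral>\<^sup>+\<sigma>. indicator X \<sigma> \<partial>\<Lambda>)"
      using leX X' po neg fin by (intro nn_integral_less) auto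
    then show False using le by simp
  qed
  moreover have "AE \<sigma> in \<Lambda>. \<sigma> \<in> code_space M" using props(3) by (metis AE_space)
  ultimately show ?thesis
  proof eventually_elim
    case (elim \<sigma>)
    show ?case
    proof (rule ccontr)
      assume "\<not> path_op q wb f \<sigma> \<ge> 1"
      moreover from this have "\<sigma> \<in> X" using elim(2) by (simp add: X_def not_le)
      ultimately show False using elim(1) by simp
    qed
  qed
qed

lemma invariant_image_iff:
  assumes \<Lambda>: "\<Lambda> \<in> shift_invariant_measures M" and dom: "emeasure \<Lambda> (coding_dom M x) = 1"
  shows "coding_image M x \<Lambda> \<in> invariant_measures M \<longleftrightarrow>
    (\<forall>f\<in>bounded_borel_nonneg.
       (\<integral>\<^sup>+\<sigma>. markov_op M (\<lambda>y. ennreal (f y)) (past_map M x \<sigma>) \<partial>\<Lambda>)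
       = (\<integral>\<^sup>+\<sigma>. ennreal (f (past_map M x \<sigma>)) \<partial>\<Lambda>))"
proof -
  note props = shift_invariant_props[OF \<Lambda>]
  have meas: "coding_map M x \<in> measurable \<Lambda> borel"
    using measurable_coding_map props(2) measurable_cong_sets by blast
  have "coding_image M x \<Lambda> \<in> borel_prob"
    unfolding coding_image_def borel_prob_def using prob_space.prob_space_distr[OF props(1) meas] by simp
  moreover have "(\<integral>\<^sup>+y. h y \<partial>coding_image M x \<Lambda>) = (\<integral>\<^sup>+\<sigma>. h (past_map M x \<sigma>) \<partial>\<Lambda>)"
    if "h \<in> borel_measurable borel" for h
  proof -
    have "(\<integral>\<^sup>+y. h y \<partial>coding_image M x \<Lambda>) = (\<integral>\<^sup>+\<sigma>. h (coding_map M x \<sigma>) \<partial>\<Lambda>)"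
      unfolding coding_image_def by (rule nn_integral_distr[OF meas]) (simp add: that)
    also have "\<dots> = (\<integral>\<^sup>+\<sigma>. h (past_map M x \<sigma>) \<partial>\<Lambda>)"
      using AE_coding_dom[OF \<Lambda> dom]
      by (intro nn_integral_cong_AE, eventually_elim) (simp add: coding_map_eq_past_map)
    finally show ?thesis .
  qed
  moreover have "(\<lambda>y. ennreal (f y)) \<in> borel_measurable borel" if "f \<in> bounded_borel_nonneg" for f :: "'k \<Rightarrow> real"
    using that by (auto simp: bounded_borel_nonneg_def)
  ultimately show ?thesis
    unfolding invariant_measures_def markov_adj_def by (simp add: measurable_markov_op)
qed

section \<open>Boundary states and the decomposition of a state\<close>

lemma measurable_ennreal_bounded_borel:
  "f \<in> bounded_borel_nonneg \<Longrightarrow> (\<lambda>y. ennreal (f y)) \<in> borel_measurable borel"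
  for f :: "'k \<Rightarrow> real"
  by (auto simp: bounded_borel_nonneg_def)

text \<open>The boundary weights of a point inside its own atom all vanish, which contradicts
  their total mass being at least 1.\<close>
lemma E_perp_boundary:
  assumes \<Lambda>: "\<Lambda> \<in> E_perp M x"
  shows "AE \<sigma> in \<Lambda>. past_map M x \<sigma> \<notin> atom M (tgt_ext M (\<sigma> 0))"
proof -
  obtain wb where wb: "is_wbar M wb" using is_wbar_exists by blast
  have \<Lambda>': "\<Lambda> \<in> states_with_weight M x (pbdry M)" using \<Lambda> by (simp add: E_perp_def)
  have "AE \<sigma> in \<Lambda>. path_op (pbdry M) wb (\<lambda>_. 1) \<sigma> \<ge> 1"
    by (rule path_op_ge_1[OF measurable_pbdry pbdry_nonneg \<Lambda>' wb]) simp_all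
  then show ?thesis
  proof eventually_elim
    case (elim \<sigma>)
    show ?case
    proof
      assume in_atom: "past_map M x \<sigma> \<in> atom M (tgt_ext M (\<sigma> 0))"
      have "path_weight (pbdry M) e \<sigma> = 0" for e
        using in_atom pbdry_eq_0[of "past_map M x \<sigma>" e] by (auto simp: path_weight_def)
      then have "path_op (pbdry M) wb (\<lambda>_. 1) \<sigma> = 0" by (simp add: path_op_def)
      then show False using elim by simp
    qed
  qed
qed

text \<open>Outside the atom where an edge starts, the boundary weight and the full
  extended weight coincide.\<close>
lemma E_perp_subset_E_tilde: "E_perp M x \<subseteq> E_tilde M x"
proof
  fix \<Lambda> assume \<Lambda>: "\<Lambda> \<in> E_perp M x"
  have inv: "\<Lambda> \<in> shift_invariant_measures M" and dom: "emeasure \<Lambda> (coding_dom M x) = 1"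
    using \<Lambda> by (simp_all add: E_perp_def states_with_weight_def)
  have "AE \<sigma> in \<Lambda>. real_cond_exp \<Lambda> (past_algebra M) (indicator (cylinder M 1 1 (\<lambda>_. Some e))) \<sigma> =
           pbar M e (coding_map M x \<sigma>) * indicator (paths_ending_at M (src M e)) \<sigma>" if e: "e \<in> edges M" for e
  proof -
    have "AE \<sigma> in \<Lambda>. real_cond_exp \<Lambda> (past_algebra M) (indicator (cylinder M 1 1 (\<lambda>_. Some e))) \<sigma> =
           pbdry M e (coding_map M x \<sigma>) * indicator (paths_ending_at M (src M e)) \<sigma>"
      using \<Lambda> e by (simp add: E_perp_def states_with_weight_def)
    then show ?thesis
      using E_perp_boundary[OF \<Lambda>] AE_coding_dom[OF inv dom]
    proof eventually_elim
      case (elim \<sigma>)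
      show ?case
      proof (cases "\<sigma> \<in> paths_ending_at M (src M e)")
        case True
        then have "coding_map M x \<sigma> \<notin> atom M (src M e)"
          using elim(2) coding_map_eq_past_map[OF elim(3)] by (simp add: paths_ending_at_def)
        then show ?thesis using elim(1) by (simp add: pbdry_eq_pbar)
      qed (use elim(1) in simp)
    qed
  qed
  then show "\<Lambda> \<in> E_tilde M x"
    using inv dom by (simp add: E_tilde_def states_with_weight_def)
qed

text \<open>The existential quantifier over the atom presents the set as a countable union of conditions
  on the past.\<close>
definition inner_part :: "(int \<Rightarrow> 'e option) set" where
  "inner_part = {\<sigma> \<in> code_space M. \<exists>j. j \<in> vertices M \<and> tgt_ext M (\<sigma> 0) = j \<and> past_map M x \<sigma> \<in> atom M j}"

lemma inner_part_sets: "inner_part \<in> sets (past_algebra M)"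
proof -
  have "{\<sigma> \<in> space (past_algebra M). j \<in> vertices M \<and> tgt_ext M (\<sigma> 0) = j \<and> past_map M x \<sigma> \<in> atom M j}
      \<in> sets (past_algebra M)" for j
  proof (cases "j \<in> vertices M")
    case True
    have tgt: "{\<sigma> \<in> space (past_algebra M). tgt_ext M (\<sigma> 0) = j} \<in> sets (past_algebra M)"
      using measurable_sets[OF measurable_past_letter[of 0], of "{a. tgt_ext M a = j}"]
      by (simp add: vimage_def Int_def conj_commute)
    have "{\<sigma> \<in> space (past_algebra M). past_map M x \<sigma> \<in> atom M j} \<in> sets (past_algebra M)"
      using measurable_sets[OF measurable_past_map atom_borel[OF True]]
      by (simp add: vimage_def Int_def conj_commute)
    from sets.sets_Collect_conj[OF this tgt] show ?thesis using True by simp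
  qed simp
  then have "{\<sigma> \<in> space (past_algebra M). \<exists>j. j \<in> vertices M \<and> tgt_ext M (\<sigma> 0) = j \<and> past_map M x \<sigma> \<in> atom M j}
      \<in> sets (past_algebra M)"
    by (rule sets.sets_Collect_countable_Ex)
  then show ?thesis by (simp add: inner_part_def)
qed

lemma inner_part_iff:
  assumes "\<sigma> \<in> coding_dom M x"
  shows "\<sigma> \<in> inner_part \<longleftrightarrow> past_map M x \<sigma> \<in> atom M (tgt_ext M (\<sigma> 0))"
  using assms path_vertices[of \<sigma> 0] by (auto simp: inner_part_def coding_dom_def path_space_def)

text \<open>An edge sends the atom where it starts into the atom where it ends, so a path never leaves the
  inner part.\<close>
lemma inner_part_shift:
  assumes \<sigma>: "\<sigma> \<in> coding_dom M x" and inner: "\<sigma> \<in> inner_part"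
  shows "code_shift \<sigma> \<in> inner_part"
proof -
  have "\<sigma> \<in> path_space M" using \<sigma> by (simp add: coding_dom_def)
  then obtain e where e: "e \<in> edges M" "\<sigma> 1 = Some e" by (rule path_letterE)
  note shift = coding_dom_shift[OF \<sigma> e(2)]
  have "past_map M x \<sigma> \<in> atom M (src M e)"
    using inner_part_iff[OF \<sigma>] inner shift(3) by simp
  then have "past_map M x (code_shift \<sigma>) \<in> atom M (tgt M e)"
    unfolding shift(2) wbar_props(2)[OF e(1) \<open>past_map M x \<sigma> \<in> atom M (src M e)\<close>]
    by (rule edge_props(5)[OF e(1)])
  then show ?thesis
    using inner_part_iff[OF shift(1)] e(2) by (simp add: code_shift_def tgt_ext_def)
qed

text \<open>A forward invariant set is contained, up to a null set, in its preimage; both have the same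
  finite measure, so they differ by a null set only.\<close>
lemma AE_inner_part_shift_iff:
  assumes \<Lambda>: "\<Lambda> \<in> shift_invariant_measures M" and dom: "emeasure \<Lambda> (coding_dom M x) = 1"
  shows "AE \<sigma> in \<Lambda>. code_shift \<sigma> \<in> inner_part \<longleftrightarrow> \<sigma> \<in> inner_part"
proof -
  note props = shift_invariant_props[OF \<Lambda>]
  interpret prob_space \<Lambda> by (rule props(1))
  have A: "inner_part \<in> sets \<Lambda>" using inner_part_sets props(6) by (auto simp: subalgebra_def)
  define B where "B = code_shift -` inner_part \<inter> space \<Lambda>"
  have B: "B \<in> sets \<Lambda>"
    unfolding B_def by (rule measurable_sets[OF props(5)]) (use A props(2) in simp)
  have "emeasure \<Lambda> B = emeasure (distr \<Lambda> (code_borel M) code_shift) inner_part"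
    unfolding B_def using A props(2) by (intro emeasure_distr[OF props(5), symmetric]) simp
  then have B_eq: "emeasure \<Lambda> B = emeasure \<Lambda> inner_part" unfolding props(4) .
  have AE_B: "AE \<sigma> in \<Lambda>. \<sigma> \<in> inner_part \<longrightarrow> \<sigma> \<in> B"
    using AE_coding_dom[OF \<Lambda> dom] AE_space
    by eventually_elim (simp add: B_def inner_part_shift)
  have "AE \<sigma> in \<Lambda>. \<sigma> \<in> B \<inter> inner_part \<longleftrightarrow> \<sigma> \<in> inner_part"
    using AE_B by eventually_elim blast
  then have "emeasure \<Lambda> (B \<inter> inner_part) = emeasure \<Lambda> inner_part"
    by (rule emeasure_eq_AE) (use A B in auto)
  then have "emeasure \<Lambda> (B - inner_part) = 0"
    using A B B_eq emeasure_Diff[of \<Lambda> "B \<inter> inner_part" B] by (simp add: Diff_Int)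
  then have "AE \<sigma> in \<Lambda>. \<sigma> \<notin> B - inner_part"
    using A B by (intro AE_not_in) (auto simp: null_sets_def)
  then show ?thesis
    using AE_B AE_space by eventually_elim (auto simp: B_def)
qed

lemma nn_integral_inner_part_shift:
  assumes \<Lambda>: "\<Lambda> \<in> shift_invariant_measures M" and dom: "emeasure \<Lambda> (coding_dom M x) = 1"
    and h: "h \<in> borel_measurable (code_borel M)"
  shows "(\<integral>\<^sup>+\<sigma>. indicator inner_part \<sigma> * h (code_shift \<sigma>) \<partial>\<Lambda>) = (\<integral>\<^sup>+\<sigma>. indicator inner_part \<sigma> * h \<sigma> \<partial>\<Lambda>)"
    "(\<integral>\<^sup>+\<sigma>. indicator (- inner_part) \<sigma> * h (code_shift \<sigma>) \<partial>\<Lambda>) = (\<integral>\<^sup>+\<sigma>. indicator (- inner_part) \<sigma> * h \<sigma> \<partial>\<Lambda>)"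
proof -
  have A: "(indicator inner_part :: _ \<Rightarrow> ennreal) \<in> borel_measurable (code_borel M)"
    by (rule measurable_past_imp_code_borel) (rule borel_measurable_indicator[OF inner_part_sets])
  have B: "(indicator (- inner_part) :: _ \<Rightarrow> ennreal) \<in> borel_measurable (code_borel M)"
  proof -
    have "(\<lambda>\<sigma>. 1 - indicator inner_part \<sigma> :: ennreal) \<in> borel_measurable (code_borel M)"
      using A by simp
    then show ?thesis by (rule measurable_cong[THEN iffD1, rotated]) (simp add: indicator_def)
  qed
  have "(\<integral>\<^sup>+\<sigma>. indicator inner_part \<sigma> * h (code_shift \<sigma>) \<partial>\<Lambda>)
      = (\<integral>\<^sup>+\<sigma>. indicator inner_part (code_shift \<sigma>) * h (code_shift \<sigma>) \<partial>\<Lambda>)"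
    using AE_inner_part_shift_iff[OF \<Lambda> dom]
    by (intro nn_integral_cong_AE, eventually_elim) (simp add: indicator_def)
  also have "\<dots> = (\<integral>\<^sup>+\<sigma>. indicator inner_part \<sigma> * h \<sigma> \<partial>\<Lambda>)"
    by (rule nn_integral_shift[OF \<Lambda> borel_measurable_times_ennreal[OF A h]])
  finally show "(\<integral>\<^sup>+\<sigma>. indicator inner_part \<sigma> * h (code_shift \<sigma>) \<partial>\<Lambda>) = (\<integral>\<^sup>+\<sigma>. indicator inner_part \<sigma> * h \<sigma> \<partial>\<Lambda>)" .
  have "(\<integral>\<^sup>+\<sigma>. indicator (- inner_part) \<sigma> * h (code_shift \<sigma>) \<partial>\<Lambda>)
      = (\<integral>\<^sup>+\<sigma>. indicator (- inner_part) (code_shift \<sigma>) * h (code_shift \<sigma>) \<partial>\<Lambda>)"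
    using AE_inner_part_shift_iff[OF \<Lambda> dom]
    by (intro nn_integral_cong_AE, eventually_elim) (simp add: indicator_def)
  also have "\<dots> = (\<integral>\<^sup>+\<sigma>. indicator (- inner_part) \<sigma> * h \<sigma> \<partial>\<Lambda>)"
    by (rule nn_integral_shift[OF \<Lambda> borel_measurable_times_ennreal[OF B h]])
  finally show "(\<integral>\<^sup>+\<sigma>. indicator (- inner_part) \<sigma> * h (code_shift \<sigma>) \<partial>\<Lambda>) = (\<integral>\<^sup>+\<sigma>. indicator (- inner_part) \<sigma> * h \<sigma> \<partial>\<Lambda>)" .
qed

text \<open>A point of an atom sees only the edges that start there, and for these the extensions agree with
  the original data.\<close>
lemma path_op_inner:
  assumes wb: "is_wbar M wb" and \<sigma>: "\<sigma> \<in> coding_dom M x" "\<sigma> \<in> inner_part"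
  shows "path_op (pbar M) wb f \<sigma> = markov_op M f (past_map M x \<sigma>)"
  unfolding path_op_def markov_op_eq_nn_integral
proof (rule nn_integral_cong)
  fix e assume "e \<in> space (count_space (edges M))"
  then have e: "e \<in> edges M" by simp
  have F: "past_map M x \<sigma> \<in> atom M (tgt_ext M (\<sigma> 0))" using inner_part_iff \<sigma> by simp
  have t: "tgt_ext M (\<sigma> 0) \<in> vertices M"
    using \<sigma>(1) path_vertices by (simp add: coding_dom_def)
  show "ennreal (path_weight (pbar M) e \<sigma>) * f (wb e (past_map M x \<sigma>))
      = ennreal (pmap M e (past_map M x \<sigma>)) * f (wmap M e (past_map M x \<sigma>))"
  proof (cases "tgt_ext M (\<sigma> 0) = src M e")
    case True
    then show ?thesis
      using F by (simp add: path_weight_def pbar_eq_pmap[OF e] is_wbar_eq(3)[OF wb e])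
  next
    case False
    then have "past_map M x \<sigma> \<notin> atom M (src M e)"
      using atoms_disjoint[OF t edge_props(1)[OF e] F] by blast
    then show ?thesis using False by (simp add: path_weight_def edge_props(7)[OF e])
  qed
qed

text \<open>The inner part of a state always contributes an invariant measure; an obstruction to
  consistency can only come from the outer part.\<close>
lemma inner_part_balance:
  assumes \<Lambda>: "\<Lambda> \<in> E_tilde M x" and f: "f \<in> borel_measurable borel"
  shows "(\<integral>\<^sup>+\<sigma>. indicator inner_part \<sigma> * markov_op M f (past_map M x \<sigma>) \<partial>\<Lambda>)
    = (\<integral>\<^sup>+\<sigma>. indicator inner_part \<sigma> * f (past_map M x \<sigma>) \<partial>\<Lambda>)"
proof -
  obtain wb where wb: "is_wbar M wb" using is_wbar_exists by blast
  have \<Lambda>': "\<Lambda> \<in> states_with_weight M x (pbar M)" using \<Lambda> by (simp add: E_tilde_def)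
  then have inv: "\<Lambda> \<in> shift_invariant_measures M" and dom: "emeasure \<Lambda> (coding_dom M x) = 1"
    by (simp_all add: states_with_weight_def)
  have "(\<integral>\<^sup>+\<sigma>. indicator inner_part \<sigma> * f (past_map M x \<sigma>) \<partial>\<Lambda>)
      = (\<integral>\<^sup>+\<sigma>. indicator inner_part \<sigma> * f (past_map M x (code_shift \<sigma>)) \<partial>\<Lambda>)"
    by (rule nn_integral_inner_part_shift(1)[OF inv dom, symmetric])
      (rule measurable_compose[OF measurable_past_imp_code_borel[OF measurable_past_map] f])
  also have "\<dots> = (\<integral>\<^sup>+\<sigma>. indicator inner_part \<sigma> * path_op (pbar M) wb f \<sigma> \<partial>\<Lambda>)"
    by (rule one_step_identity[OF measurable_pbar pbar_nonneg \<Lambda>' wb f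
          borel_measurable_indicator[OF inner_part_sets]])
  also have "\<dots> = (\<integral>\<^sup>+\<sigma>. indicator inner_part \<sigma> * markov_op M f (past_map M x \<sigma>) \<partial>\<Lambda>)"
    using AE_coding_dom[OF inv dom]
    by (intro nn_integral_cong_AE, eventually_elim) (simp add: indicator_def path_op_inner[OF wb])
  finally show ?thesis ..
qed

definition outer_part :: "(int \<Rightarrow> 'e option) set" where
  "outer_part = code_space M - inner_part"

lemma outer_part_sets: "outer_part \<in> sets (past_algebra M)"
  using sets.compl_sets[OF inner_part_sets] by (simp add: outer_part_def)

text \<open>The outer part is shift-invariant up to null sets and belongs to the past. Hence conditioning on it preserves
  invariance and the conditional probabilities of the next letter, and on it these
  probabilities are the boundary weights.\<close>
lemma conditioned_outer_part_in_E_perp: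
  assumes \<Lambda>: "\<Lambda> \<in> E_tilde M x" and pos: "emeasure \<Lambda> outer_part \<noteq> 0"
  shows "uniform_measure \<Lambda> outer_part \<in> E_perp M x"
proof -
  have \<Lambda>': "\<Lambda> \<in> states_with_weight M x (pbar M)" using \<Lambda> by (simp add: E_tilde_def)
  then have inv: "\<Lambda> \<in> shift_invariant_measures M" and dom: "emeasure \<Lambda> (coding_dom M x) = 1"
    by (simp_all add: states_with_weight_def)
  note props = shift_invariant_props[OF inv]
  interpret prob_space \<Lambda> by (rule props(1))
  let ?U = "uniform_measure \<Lambda> outer_part"
  have B: "outer_part \<in> sets \<Lambda>" using outer_part_sets props(6) by (auto simp: subalgebra_def)
  have fin: "emeasure \<Lambda> outer_part \<noteq> \<infinity>" by simp
  have "prob_space ?U" using pos fin by (rule prob_space_uniform_measure)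
  moreover have "distr ?U (code_borel M) code_shift = ?U"
  proof (rule measure_eqI)
    show "sets (distr ?U (code_borel M) code_shift) = sets ?U" using props(2) by simp
    fix X assume "X \<in> sets (distr ?U (code_borel M) code_shift)"
    then have X: "X \<in> sets (code_borel M)" "X \<in> sets \<Lambda>" using props(2) by auto
    have S: "code_shift -` X \<inter> space \<Lambda> \<in> sets \<Lambda>" by (rule measurable_sets[OF props(5) X(1)])
    have "emeasure \<Lambda> (outer_part \<inter> (code_shift -` X \<inter> space \<Lambda>))
        = (\<integral>\<^sup>+\<sigma>. indicator (outer_part \<inter> (code_shift -` X \<inter> space \<Lambda>)) \<sigma> \<partial>\<Lambda>)"
      by (rule nn_integral_indicator[symmetric, OF sets.Int[OF B S]])
    also have "\<dots> = (\<integral>\<^sup>+\<sigma>. indicator (- inner_part) \<sigma> * indicator X (code_shift \<sigma>) \<partial>\<Lambda>)"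
      using props(3) by (intro nn_integral_cong) (auto simp: outer_part_def indicator_def)
    also have "\<dots> = (\<integral>\<^sup>+\<sigma>. indicator (- inner_part) \<sigma> * indicator X \<sigma> \<partial>\<Lambda>)"
      by (rule nn_integral_inner_part_shift(2)[OF inv dom borel_measurable_indicator[OF X(1)]])
    also have "\<dots> = (\<integral>\<^sup>+\<sigma>. indicator (outer_part \<inter> X) \<sigma> \<partial>\<Lambda>)"
      using props(3) by (intro nn_integral_cong) (auto simp: outer_part_def indicator_def)
    also have "\<dots> = emeasure \<Lambda> (outer_part \<inter> X)"
      by (rule nn_integral_indicator[OF sets.Int[OF B X(2)]])
    finally have "emeasure \<Lambda> (outer_part \<inter> (code_shift -` X \<inter> space \<Lambda>)) = emeasure \<Lambda> (outer_part \<inter> X)" .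
    moreover have "code_shift \<in> measurable ?U (code_borel M)"
      using props(5) by (simp cong: measurable_cong_sets)
    ultimately show "emeasure (distr ?U (code_borel M) code_shift) X = emeasure ?U X"
      using X B S by (simp add: emeasure_distr)
  qed
  ultimately have invU: "?U \<in> shift_invariant_measures M"
    using props(2) by (simp add: shift_invariant_measures_def)
  have D: "coding_dom M x \<in> sets \<Lambda>" using coding_dom_sets props(2) by simp
  have "emeasure \<Lambda> (outer_part \<inter> coding_dom M x) = emeasure \<Lambda> outer_part"
  proof (rule emeasure_eq_AE)
    show "AE \<sigma> in \<Lambda>. \<sigma> \<in> outer_part \<inter> coding_dom M x \<longleftrightarrow> \<sigma> \<in> outer_part"
      using AE_coding_dom[OF inv dom] by eventually_elim blast
  qed (use B D in auto)
  then have domU: "emeasure ?U (coding_dom M x) = 1"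
    using B D pos by (simp add: ennreal_divide_self less_top[symmetric])
  have weightU: "(\<integral>\<^sup>+\<sigma>. g \<sigma> * indicator (cylinder M 1 1 (\<lambda>_. Some e)) \<sigma> \<partial>?U)
       = (\<integral>\<^sup>+\<sigma>. g \<sigma> * ennreal (path_weight (pbdry M) e \<sigma>) \<partial>?U)"
    if e: "e \<in> edges M" and g: "g \<in> borel_measurable (past_algebra M)" for e g
  proof -
    let ?C = "cylinder M 1 1 (\<lambda>_. Some e)"
    have C: "?C \<in> sets \<Lambda>" using cylinder_in_code_borel props(2) by simp
    have g': "g \<in> borel_measurable \<Lambda>" by (rule measurable_from_subalg[OF props(6) g])
    have gB: "(\<lambda>\<sigma>. g \<sigma> * indicator outer_part \<sigma>) \<in> borel_measurable (past_algebra M)"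
      by (intro borel_measurable_times_ennreal g borel_measurable_indicator outer_part_sets)
    have pw: "(\<lambda>\<sigma>. ennreal (path_weight (pbdry M) e \<sigma>)) \<in> borel_measurable \<Lambda>"
      by (rule measurable_from_subalg[OF props(6) measurable_compose[OF
              measurable_path_weight[of "pbdry M", OF measurable_pbdry[OF e]] measurable_ennreal]])
    have "(\<integral>\<^sup>+\<sigma>. g \<sigma> * indicator ?C \<sigma> * indicator outer_part \<sigma> \<partial>\<Lambda>)
        = (\<integral>\<^sup>+\<sigma>. (g \<sigma> * indicator outer_part \<sigma>) * indicator ?C \<sigma> \<partial>\<Lambda>)"
      by (simp add: ac_simps)
    also have "\<dots> = (\<integral>\<^sup>+\<sigma>. (g \<sigma> * indicator outer_part \<sigma>) * ennreal (path_weight (pbar M) e \<sigma>) \<partial>\<Lambda>)"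
      by (rule states_with_weight_integral[OF measurable_pbar pbar_nonneg \<Lambda>' e gB])
    also have "\<dots> = (\<integral>\<^sup>+\<sigma>. g \<sigma> * ennreal (path_weight (pbdry M) e \<sigma>) * indicator outer_part \<sigma> \<partial>\<Lambda>)"
    proof (rule nn_integral_cong_AE)
      show "AE \<sigma> in \<Lambda>. (g \<sigma> * indicator outer_part \<sigma>) * ennreal (path_weight (pbar M) e \<sigma>)
          = g \<sigma> * ennreal (path_weight (pbdry M) e \<sigma>) * indicator outer_part \<sigma>"
        using AE_coding_dom[OF inv dom]
      proof eventually_elim
        case (elim \<sigma>)
        have "path_weight (pbar M) e \<sigma> = path_weight (pbdry M) e \<sigma>" if "\<sigma> \<in> outer_part"
          using that inner_part_iff[OF elim] by (auto simp: outer_part_def path_weight_def pbdry_eq_pbar)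
        then show ?case by (simp add: indicator_def)
      qed
    qed
    finally have eq: "(\<integral>\<^sup>+\<sigma>. g \<sigma> * indicator ?C \<sigma> * indicator outer_part \<sigma> \<partial>\<Lambda>)
        = (\<integral>\<^sup>+\<sigma>. g \<sigma> * ennreal (path_weight (pbdry M) e \<sigma>) * indicator outer_part \<sigma> \<partial>\<Lambda>)" .
    have "(\<lambda>\<sigma>. g \<sigma> * indicator ?C \<sigma>) \<in> borel_measurable \<Lambda>"
      "(\<lambda>\<sigma>. g \<sigma> * ennreal (path_weight (pbdry M) e \<sigma>)) \<in> borel_measurable \<Lambda>"
      by (intro borel_measurable_times_ennreal g' pw borel_measurable_indicator C)+
    then show ?thesis using B eq by (simp only: nn_integral_uniform_measure)
  qed
  have "?U \<in> states_with_weight M x (pbdry M)"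
    using invU domU weightU states_with_weight_iff[of "pbdry M" ?U, OF measurable_pbdry pbdry_nonneg] by blast
  then show ?thesis by (simp add: E_perp_def)
qed

lemma consistent_if_boundary_states:
  assumes perp: "\<And>\<Lambda>. \<Lambda> \<in> E_perp M x \<Longrightarrow> coding_image M x \<Lambda> \<in> invariant_measures M"
  shows "consistent M x"
  unfolding consistent_def
proof
  fix \<Lambda> assume \<Lambda>: "\<Lambda> \<in> E_tilde M x"
  then have inv: "\<Lambda> \<in> shift_invariant_measures M" and dom: "emeasure \<Lambda> (coding_dom M x) = 1"
    by (simp_all add: E_tilde_def states_with_weight_def)
  note props = shift_invariant_props[OF inv]
  interpret prob_space \<Lambda> by (rule props(1))
  have A: "inner_part \<in> sets \<Lambda>" and B: "outer_part \<in> sets \<Lambda>"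
    using inner_part_sets outer_part_sets props(6) by (auto simp: subalgebra_def)
  have past: "past_map M x \<in> measurable \<Lambda> borel"
    by (rule measurable_from_subalg[OF props(6) measurable_past_map])
  show "coding_image M x \<Lambda> \<in> invariant_measures M"
    unfolding invariant_image_iff[OF inv dom]
  proof
    fix f :: "'k \<Rightarrow> real" assume f: "f \<in> bounded_borel_nonneg"
    note f' = measurable_ennreal_bounded_borel[OF f]
    let ?Uf = "\<lambda>\<sigma>. markov_op M (\<lambda>y. ennreal (f y)) (past_map M x \<sigma>)" and ?f = "\<lambda>\<sigma>. ennreal (f (past_map M x \<sigma>))"
    have m: "?Uf \<in> borel_measurable \<Lambda>" "?f \<in> borel_measurable \<Lambda>"
      by (rule measurable_compose[OF past measurable_markov_op[OF f']], rule measurable_compose[OF past f'])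
    have outer: "(\<integral>\<^sup>+\<sigma>. ?Uf \<sigma> * indicator outer_part \<sigma> \<partial>\<Lambda>) = (\<integral>\<^sup>+\<sigma>. ?f \<sigma> * indicator outer_part \<sigma> \<partial>\<Lambda>)"
    proof (cases "emeasure \<Lambda> outer_part = 0")
      case True
      then have "AE \<sigma> in \<Lambda>. \<sigma> \<notin> outer_part"
        using B by (intro AE_not_in) (simp add: null_sets_def)
      then show ?thesis by (intro nn_integral_cong_AE, eventually_elim) simp
    next
      case False
      let ?c = "emeasure \<Lambda> outer_part"
      have U: "uniform_measure \<Lambda> outer_part \<in> E_perp M x"
        by (rule conditioned_outer_part_in_E_perp[OF \<Lambda> False])
      then have "uniform_measure \<Lambda> outer_part \<in> shift_invariant_measures M"
        "emeasure (uniform_measure \<Lambda> outer_part) (coding_dom M x) = 1"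
        by (simp_all only: E_perp_def states_with_weight_def mem_Collect_eq)
      then have "(\<integral>\<^sup>+\<sigma>. ?Uf \<sigma> \<partial>uniform_measure \<Lambda> outer_part) = (\<integral>\<^sup>+\<sigma>. ?f \<sigma> \<partial>uniform_measure \<Lambda> outer_part)"
        using perp[OF U] f invariant_image_iff by blast
      then have eq: "(\<integral>\<^sup>+\<sigma>. ?Uf \<sigma> * indicator outer_part \<sigma> \<partial>\<Lambda>) / ?c
          = (\<integral>\<^sup>+\<sigma>. ?f \<sigma> * indicator outer_part \<sigma> \<partial>\<Lambda>) / ?c"
        unfolding nn_integral_uniform_measure[OF m(1) B] nn_integral_uniform_measure[OF m(2) B] .
      have cancel: "a / ?c * ?c = a" for a
        unfolding ennreal_divide_times by (subst ennreal_divide_self) (use False in \<open>simp_all add: less_top[symmetric]\<close>)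
      show ?thesis using arg_cong[OF eq, of "\<lambda>a. a * ?c"] unfolding cancel .
    qed
    have split: "(\<integral>\<^sup>+\<sigma>. h \<sigma> \<partial>\<Lambda>) = (\<integral>\<^sup>+\<sigma>. indicator inner_part \<sigma> * h \<sigma> \<partial>\<Lambda>) + (\<integral>\<^sup>+\<sigma>. h \<sigma> * indicator outer_part \<sigma> \<partial>\<Lambda>)"
      if "h \<in> borel_measurable \<Lambda>" for h
    proof -
      have "(\<integral>\<^sup>+\<sigma>. h \<sigma> \<partial>\<Lambda>) = (\<integral>\<^sup>+\<sigma>. indicator inner_part \<sigma> * h \<sigma> + h \<sigma> * indicator outer_part \<sigma> \<partial>\<Lambda>)"
        using props(3) by (intro nn_integral_cong) (simp add: outer_part_def indicator_def)
      also have "\<dots> = (\<integral>\<^sup>+\<sigma>. indicator inner_part \<sigma> * h \<sigma> \<partial>\<Lambda>) + (\<integral>\<^sup>+\<sigma>. h \<sigma> * indicator outer_part \<sigma> \<partial>\<Lambda>)"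
        by (intro nn_integral_add borel_measurable_times_ennreal borel_measurable_indicator that A B)
      finally show ?thesis .
    qed
    show "(\<integral>\<^sup>+\<sigma>. ?Uf \<sigma> \<partial>\<Lambda>) = (\<integral>\<^sup>+\<sigma>. ?f \<sigma> \<partial>\<Lambda>)"
      unfolding split[OF m(1)] split[OF m(2)] outer inner_part_balance[OF \<Lambda> f'] ..
  qed
qed

lemma consistent_iff_boundary_states:
  "consistent M x \<longleftrightarrow> (\<forall>\<Lambda>\<in>E_perp M x. coding_image M x \<Lambda> \<in> invariant_measures M)"
  using E_perp_subset_E_tilde consistent_if_boundary_states by (auto simp: consistent_def)

section \<open>Domination by the Markov operator\<close>

text \<open>Dropping the restriction to edges that start in the current atom only increases the average, so
  the boundary operator dominates the conditional mean, and the lower bound 1 propagates by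
  induction through its iterates.\<close>
lemma E_perp_AE_Omega:
  assumes \<Lambda>: "\<Lambda> \<in> E_perp M x" and wb: "is_wbar M wb"
  shows "AE \<sigma> in \<Lambda>. past_map M x \<sigma> \<in> Omega M wb"
proof -
  let ?R = "\<lambda>n. (bdry_op M wb ^^ n) (\<lambda>_. 1)"
  have \<Lambda>': "\<Lambda> \<in> states_with_weight M x (pbdry M)" using \<Lambda> by (simp add: E_perp_def)
  have "?R n \<in> borel_measurable borel \<and> (AE \<sigma> in \<Lambda>. ?R n (past_map M x \<sigma>) \<ge> 1)" for n
  proof (induction n)
    case (Suc n)
    have "AE \<sigma> in \<Lambda>. path_op (pbdry M) wb (?R n) \<sigma> \<ge> 1"
      using Suc by (intro path_op_ge_1[OF measurable_pbdry pbdry_nonneg \<Lambda>' wb]) simp_all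
    moreover have "path_op (pbdry M) wb (?R n) \<sigma> \<le> bdry_op M wb (?R n) (past_map M x \<sigma>)" for \<sigma>
      unfolding path_op_def bdry_op_eq_nn_integral
      by (intro nn_integral_mono mult_right_mono ennreal_leI) (simp_all add: path_weight_def pbdry_nonneg)
    ultimately have "AE \<sigma> in \<Lambda>. bdry_op M wb (?R n) (past_map M x \<sigma>) \<ge> 1"
      using order_trans by fastforce
    then show ?case using Suc measurable_bdry_op[OF _ wb] by simp
  qed simp
  then have "AE \<sigma> in \<Lambda>. \<forall>n. ?R n (past_map M x \<sigma>) \<ge> 1"
    by (simp add: AE_all_countable)
  then show ?thesis by eventually_elim (simp add: Omega_def)
qed

text \<open>For a boundary state the one-step identity and the hypothesis give that the image measure
  \<open>\<nu>\<close> satisfies \<open>\<nu>(f) \<le> \<nu>(Uf)\<close> for every bounded \<^term>\<open>f\<close>. As \<open>U\<close> fixes constants, applying this to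
  \<open>c - f\<close> gives the reverse inequality.\<close>
lemma consistent_if_dominated:
  assumes wb: "is_wbar M wb"
    and dominated: "\<And>\<sigma> f. \<sigma> \<in> code_space M \<Longrightarrow> coding_map M x \<sigma> \<in> Omega M wb \<Longrightarrow> f \<in> bounded_borel_nonneg \<Longrightarrow>
        bdry_op M wb (\<lambda>y. ennreal (f y)) (coding_map M x \<sigma>) \<le> markov_op M (\<lambda>y. ennreal (f y)) (coding_map M x \<sigma>)"
  shows "consistent M x"
proof (rule consistent_if_boundary_states)
  fix \<Lambda> assume \<Lambda>: "\<Lambda> \<in> E_perp M x"
  have \<Lambda>': "\<Lambda> \<in> states_with_weight M x (pbdry M)" using \<Lambda> by (simp add: E_perp_def)
  then have inv: "\<Lambda> \<in> shift_invariant_measures M" and dom: "emeasure \<Lambda> (coding_dom M x) = 1"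
    by (simp_all add: states_with_weight_def)
  note props = shift_invariant_props[OF inv]
  interpret prob_space \<Lambda> by (rule props(1))
  have past: "past_map M x \<in> measurable \<Lambda> borel"
    by (rule measurable_from_subalg[OF props(6) measurable_past_map])
  let ?U = "\<lambda>f. \<integral>\<^sup>+\<sigma>. markov_op M (\<lambda>y. ennreal (f y)) (past_map M x \<sigma>) \<partial>\<Lambda>"
    and ?I = "\<lambda>f. \<integral>\<^sup>+\<sigma>. ennreal (f (past_map M x \<sigma>)) \<partial>\<Lambda>"
  have sub: "?I f \<le> ?U f" if f: "f \<in> bounded_borel_nonneg" for f
  proof -
    note f' = measurable_ennreal_bounded_borel[OF f]
    have "?I f = (\<integral>\<^sup>+\<sigma>. 1 * ennreal (f (past_map M x (code_shift \<sigma>))) \<partial>\<Lambda>)"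
      using nn_integral_shift[OF inv measurable_compose[OF measurable_past_imp_code_borel[OF measurable_past_map] f']]
      by simp
    also have "\<dots> = (\<integral>\<^sup>+\<sigma>. 1 * path_op (pbdry M) wb (\<lambda>y. ennreal (f y)) \<sigma> \<partial>\<Lambda>)"
      by (rule one_step_identity[OF measurable_pbdry pbdry_nonneg \<Lambda>' wb f' measurable_const]) simp_all
    also have "\<dots> \<le> ?U f"
    proof (rule nn_integral_mono_AE)
      show "AE \<sigma> in \<Lambda>. 1 * path_op (pbdry M) wb (\<lambda>y. ennreal (f y)) \<sigma>
          \<le> markov_op M (\<lambda>y. ennreal (f y)) (past_map M x \<sigma>)"
        using AE_coding_dom[OF inv dom] E_perp_AE_Omega[OF \<Lambda> wb]
      proof eventually_elim
        case (elim \<sigma>)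
        have "1 * path_op (pbdry M) wb (\<lambda>y. ennreal (f y)) \<sigma> \<le> bdry_op M wb (\<lambda>y. ennreal (f y)) (past_map M x \<sigma>)"
          unfolding path_op_def bdry_op_eq_nn_integral mult_1
          by (intro nn_integral_mono mult_right_mono ennreal_leI) (simp_all add: path_weight_def pbdry_nonneg)
        also have "\<dots> \<le> markov_op M (\<lambda>y. ennreal (f y)) (past_map M x \<sigma>)"
          using dominated[of \<sigma> f] f elim coding_map_eq_past_map[OF elim(1)]
          by (simp add: coding_dom_def path_space_def)
        finally show ?case .
      qed
    qed
    finally show ?thesis .
  qed
  show "coding_image M x \<Lambda> \<in> invariant_measures M"
    unfolding invariant_image_iff[OF inv dom]
  proof
    fix f :: "'k \<Rightarrow> real" assume f: "f \<in> bounded_borel_nonneg"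
    then have f0: "\<And>y. f y \<ge> 0" and fm: "f \<in> borel_measurable borel" and "bounded (range f)"
      by (simp_all add: bounded_borel_nonneg_def)
    then obtain c where "\<And>y. \<bar>f y\<bar> \<le> c"
      unfolding bounded_iff by auto
    then have fc: "f y \<le> c" for y using abs_le_D1 by blast
    define g where "g = (\<lambda>y. c - f y)"
    have g: "g \<in> bounded_borel_nonneg"
      unfolding bounded_borel_nonneg_def bounded_iff g_def using fc f0 fm
      by (auto intro!: exI[of _ c])
    note f' = measurable_ennreal_bounded_borel[OF f] and g' = measurable_ennreal_bounded_borel[OF g]
    have fg: "ennreal (f y) + ennreal (g y) = ennreal c" for y
      using f0 fc by (simp add: g_def ennreal_plus[symmetric] del: ennreal_plus)
    have "markov_op M (\<lambda>y. ennreal (f y)) y + markov_op M (\<lambda>y. ennreal (g y)) y = ennreal c" for y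
    proof -
      have "markov_op M (\<lambda>y. ennreal (f y)) y + markov_op M (\<lambda>y. ennreal (g y)) y
          = markov_op M (\<lambda>y. ennreal (f y) + ennreal (g y)) y"
        unfolding markov_op_eq_nn_integral by (simp add: nn_integral_add[symmetric] distrib_left)
      then show ?thesis by (simp add: fg markov_op_const)
    qed
    then have "?U f + ?U g = ennreal c"
      by (subst nn_integral_add[symmetric])
        (auto intro!: measurable_compose[OF past] measurable_markov_op f' g' simp: emeasure_space_1)
    moreover have "?I f + ?I g = ennreal c"
      by (subst nn_integral_add[symmetric])
        (auto intro!: measurable_compose[OF past] f' g' simp: emeasure_space_1 fg)
    ultimately have sum_eq: "?U f + ?U g = ?I f + ?I g" "?I f + ?I g \<noteq> \<top>" by auto
    have "?U f \<le> ?I f"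
    proof -
      have "?U f + ?I g \<le> ?U f + ?U g" using sub[OF g] by (intro add_left_mono)
      also have "\<dots> = ?I f + ?I g" by (rule sum_eq)
      finally have "?I g + ?U f \<le> ?I g + ?I f" by (simp add: add.commute)
      then show ?thesis using sum_eq(2) by (simp add: ennreal_add_left_cancel_le)
    qed
    then show "?U f = ?I f" using sub[OF f] by (rule antisym)
  qed
qed

end

theorem theorem3:
  fixes M :: "('k::complete_space, 'e) markov_system"
    and x :: "nat \<Rightarrow> 'k"
  assumes "countable_markov_system M"
    and "\<forall>j\<in>vertices M. x j \<in> atom M j"
  shows "(unif_continuous M \<longrightarrow>
            (consistent M x \<longleftrightarrow>
               (\<forall>\<Lambda>\<in>E_perp M x. coding_image M x \<Lambda> \<in> invariant_measures M))) \<and>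
         (\<forall>wb. unif_continuous M \<longrightarrow> is_wbar M wb \<longrightarrow>
            (\<forall>\<sigma> \<in> coding_map M x -` Omega M wb \<inter> code_space M. \<forall>f\<in>bounded_borel_nonneg.
               bdry_op M wb (\<lambda>y. ennreal (f y)) (coding_map M x \<sigma>)
                 \<le> markov_op M (\<lambda>y. ennreal (f y)) (coding_map M x \<sigma>)) \<longrightarrow>
            consistent M x)"
proof -
  have system: "coded_system M x" if "unif_continuous M"
    using assms that by unfold_locales auto
  show ?thesis
  proof (intro conjI allI impI)
    assume "unif_continuous M"
    then show "consistent M x \<longleftrightarrow> (\<forall>\<Lambda>\<in>E_perp M x. coding_image M x \<Lambda> \<in> invariant_measures M)"
      by (rule coded_system.consistent_iff_boundary_states[OF system])
  next
    fix wb
    assume "unif_continuous M" "is_wbar M wb"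
      and dominated: "\<forall>\<sigma> \<in> coding_map M x -` Omega M wb \<inter> code_space M. \<forall>f\<in>bounded_borel_nonneg.
               bdry_op M wb (\<lambda>y. ennreal (f y)) (coding_map M x \<sigma>)
                 \<le> markov_op M (\<lambda>y. ennreal (f y)) (coding_map M x \<sigma>)"
    show "consistent M x"
    proof (rule coded_system.consistent_if_dominated[OF system])
      show "unif_continuous M" "is_wbar M wb" by fact+
    qed (use dominated in blast)
  qed
qed

end
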